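(* Consider the intraday planning problem (ID) and its matrix representation specified in the context, with $g_i=|\mathcal G_i|$, $A_i=\operatorname{col}(A_{i,\mathrm{eq}},A_{i,\mathrm{in}})\in\mathbb R^{r_i\times n_i}$ and $Q_i=\nabla^2f_i$. Fix $K_\ell$. Then there is a constant $C>0$, independent of the network size, horizon length $H$, scenario count $M$, and area index, such that $$r_i+\operatorname{nnz}(A_i)+\operatorname{nnz}(Q_i)\le C\,HM(1+K_i+g_i),\qquad i\in\mathcal N .$$ For the stacked matrices $A=\operatorname{col}(A_{\mathrm{eq}},A_{\mathrm{in}})$ and $Q=\operatorname{blkdiag}(Q_1,\dots,Q_N,\mathbf 0_{NHM\times NHM})$, $$\operatorname{nnz}(A)+\operatorname{nnz}(Q)=\mathcal O\Big(HM\Big[N+|\mathcal E|+|\mathcal G|+\sum_{i\in\mathcal N}K_i\Big]\Big).$$ The same order holds for the centralized physical formulation obtained by identifying redundant angle copies and redundant node copies of the line flows, while retaining battery states and line flows as variables. If $K_i$ and $g_i$ are bounded by constants independent of $N,H,M$, then $r_i,n_i=\Theta(HM)$ and the densities of both $A_i$ and $Q_i$ are $\mathcal O((HM)^{-1})$; moreover the stacked constraint matrix $A$ has $\Theta(NHM)$ rows and columns, and its density and the density of the stacked Hessian $Q$ are $\mathcal O((NHM)^{-1})$.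
   Context: **Conventions.** $\operatorname{nnz}(A)$ is the number of nonzero entries of a real matrix $A$; the density of an $r\times n$ matrix is $\operatorname{nnz}/(rn)$. **Network and index sets.** $(\mathcal N,\mathcal E)$ is a finite graph, $\mathcal N=\{1,\dots,N\}$ (control areas), $\mathcal E\subset\mathcal N\times\mathcal N$ (lines), each line stored once with a fixed orientation $e=(\mathrm{from}(e),\mathrm{to}(e))$; there are no self-loops and at most one line joins two areas. $\mathcal N_i$ is the set of neighbours of $i$, $K_i=|\mathcal N_i|$ (also the number of lines incident on $i$). For $e$ incident on $i$ (written $e\ni i$), $\sigma_{i,e}=+1$ if $i=\mathrm{from}(e)$ and $\sigma_{i,e}=-1$ if $i=\mathrm{to}(e)$. $\mathcal I,\mathcal B,\mathcal R\subseteq\mathcal N$ are the areas having, respectively, a converter plant, a battery, and renewable injection. $\mathcal G$ is a finite set of generating units with a placement map $\mathcal G\to\mathcal N$; $\mathcal G_i$ is the set of units placed at $i$. $H,M\ge1$ are integers, $\mathcal T=\{0,\dots,H-1\}$ (stages), $\mathcal T_E=\{0,\dots,H\}$, $\mathcal M=\{1,\dots,M\}$ (scenarios), with probabilities $\pi_m>0$, $\sum_m\pi_m=1$. $\Delta_{\mathrm{ID}}=\tfrac14$ (hours). Variables of absent assets are omitted (and count as zero in sums); constraints and costs of absent assets are omitted. **Fixed data.** Real numbers: $P^{\mathrm{mot}}_i(t,m),P^{\mathrm{av}}_i(t,m),P^{\mathrm{res,max}}_i(t,m)\ge0$; unit envelopes $\overline P^{\mathrm g}_g(t,m),\overline P^{\mathrm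 p}_g(t,m)$; all scenario data at $t=0$ do not depend on $m$. Lines: $B_e>0$, $\bar P_e>0$, and loss-cut coefficients $a_{e,\kappa},b_{e,\kappa}\in\mathbb R$, $\kappa=1,\dots,K_\ell$. Batteries: $\underline E_i,\overline E_i,\overline P^{\mathrm b}_i,E^0_i,E^{\mathrm{term}}_i$, $\eta^{\mathrm c}_i,\eta^{\mathrm d}_i\in(0,1]$, references $E^{\mathrm{ref}}_i(t+1)$. Converters: $\underline P^{\mathrm{cv}}_i,\overline P^{\mathrm{cv}}_i,\Delta\overline P^{\mathrm{cv}}_i,p^{\mathrm{conv,prev}}_{i,n}$, peak targets $\bar p^{\mathrm{DA}}_i$, frozen commitments $\delta^{\mathrm{DA}}_i(h)\in\{0,1\}$ for day-ahead hours $h$ in a finite set $\mathcal H^{\mathrm{DA}}$, a map $h_n:\mathcal T\to\mathcal H^{\mathrm{DA}}$ giving the hour containing stage $t$, cleared energies $e^{\mathrm{DA}}_i(h)$ and already delivered energies $e^{\mathrm{past}}_{i,h}(n)$; $G_{n,h}=\{t\in\mathcal T:h_n(t)=h\}$. Costs: $c^{\mathrm g}_g(t),c^{\mathrm p}_g(t),a_g(t),c^{\mathrm b}_i,c^{\mathrm{ct}}_i,c^{\mathrm{rg}}_i,c^{\mathrm{pk}},w^{\mathrm{soc}}_i,\varepsilon_i\ge0$, $c^{\mathrm{ls}}>0$, and signed prices $c^E_i(t),c^{E,\mathrm x}_i(t)\in\mathbb R$. **Variables of area $i$**, collected in $x_i\in\mathbb R^{n_i}$ ($n_i$ = number of scalar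 coordinates), for all $(t,m)\in\mathcal T\times\mathcal M$ unless indicated: $p^{\mathrm{conv}}_i,q_i^+,q_i^-$ and $s^{\mathrm{pk}}_i(m)$ (if $i\in\mathcal I$; $s_i^{\mathrm{pk}}$ has one entry per scenario); $p^{\mathrm c}_i,p^{\mathrm d}_i$ and $E_i(s,m)$, $s\in\mathcal T_E$ (if $i\in\mathcal B$); $p^{\mathrm{res}}_i$ (if $i\in\mathcal R$); $p^{\mathrm g}_g,p^{\mathrm{pump}}_g$ for $g\in\mathcal G_i$; $p^{\mathrm{reg}}_i$; own angle $\theta_{i,i}$; flow copies $p^{\mathrm{flow}}_{e,i}$ for $e\ni i$; neighbour-angle copies $\theta_{j,i}$ for $j\in\mathcal N_i$; $\ell_e$ for lines with $\mathrm{from}(e)=i$. **Local feasible set $\mathcal X_i$**: all $x_i$ satisfying, for all applicable indices, (1) $0\le p^{\mathrm{reg}}_i\le P^{\mathrm{av}}_i$; (2) $p^{\mathrm{conv}}_i+\sum_{g\in\mathcal G_i}(p^{\mathrm g}_g-p^{\mathrm{pump}}_g)+p^{\mathrm d}_i-p^{\mathrm c}_i+p^{\mathrm{res}}_i+p^{\mathrm{reg}}_i-\sum_{e\ni i}\sigma_{i,e}p^{\mathrm{flow}}_{e,i}=P^{\mathrm{mot}}_i$; (3) $p^{\mathrm{flow}}_{e,i}=\sigma_{i,e}B_e(\theta_{i,i}-\theta_{j,i})$ for $e$ joining $i$ and $j$, and $|p^{\mathrm{flow}}_{e,i}|\le\bar P_e$; (4) $\ell_e\ge a_{e,\kappa}p^{\mathrm{flow}}_{e,i}+b_{e,\kappa}$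 for $i=\mathrm{from}(e)$, $\kappa=1,\dots,K_\ell$; (5) $E_i(0,m)=E_i^0$, $E_i(t+1,m)=E_i(t,m)+\Delta_{\mathrm{ID}}(\eta^{\mathrm c}_ip^{\mathrm c}_i-p^{\mathrm d}_i/\eta^{\mathrm d}_i)$, $\underline E_i\le E_i(s,m)\le\overline E_i$ ($s\in\mathcal T_E$), $0\le p^{\mathrm c}_i,p^{\mathrm d}_i\le\overline P^{\mathrm b}_i$, $E_i(H,m)\ge E^{\mathrm{term}}_i$; (6) $p^{\mathrm{conv}}_i=q_i^+-q_i^-$, $q_i^\pm\ge0$, $\delta^{\mathrm{DA}}_i(h_n(t))\underline P^{\mathrm{cv}}_i\le p^{\mathrm{conv}}_i(t,m)\le\delta^{\mathrm{DA}}_i(h_n(t))\overline P^{\mathrm{cv}}_i$, $|p^{\mathrm{conv}}_i(0,m)-p^{\mathrm{conv,prev}}_{i,n}|\le\Delta\overline P^{\mathrm{cv}}_i$, $|p^{\mathrm{conv}}_i(t,m)-p^{\mathrm{conv}}_i(t-1,m)|\le\Delta\overline P^{\mathrm{cv}}_i$ ($t\ge1$); (7) $0\le p^{\mathrm g}_g\le\overline P^{\mathrm g}_g$, $0\le p^{\mathrm{pump}}_g\le\overline P^{\mathrm p}_g$; (8) $0\le p^{\mathrm{res}}_i\le P^{\mathrm{res,max}}_i$; (9) $s^{\mathrm{pk}}_i(m)\ge q_i^+(t,m)-\bar p^{\mathrm{DA}}_i$ for all $t$, $s^{\mathrm{pk}}_i(m)\ge0$; (10) $\Delta_{\mathrm{ID}}\sum_{t\in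 G_{n,h}}p^{\mathrm{conv}}_i(t,m)=e^{\mathrm{DA}}_i(h)-e^{\mathrm{past}}_{i,h}(n)$ for every $m$ and every gate-closed hour $h$ (from a given set of hours) with $G_{n,h}\neq\emptyset$ whose remaining quarter-hours all lie in the horizon; (11) $u_i(0,m)=u_i(0,m')$ for all $m,m'$, where $u_i(t,m)=\operatorname{col}(p^{\mathrm{conv}}_i,p^{\mathrm c}_i,p^{\mathrm d}_i,p^{\mathrm{res}}_i,p^{\mathrm{reg}}_i,(p^{\mathrm g}_g,p^{\mathrm{pump}}_g)_{g\in\mathcal G_i})(t,m)$. **Objective.** With $\ell_i(t,m)=\Delta_{\mathrm{ID}}(c^E_iq_i^+-c^{E,\mathrm x}_iq_i^-)+\Delta_{\mathrm{ID}}c^{\mathrm b}_i(p^{\mathrm c}_i+p^{\mathrm d}_i)+\Delta_{\mathrm{ID}}c^{\mathrm{ct}}_i(P^{\mathrm{res,max}}_i-p^{\mathrm{res}}_i)+c^{\mathrm{pk}}s^{\mathrm{pk}}_i(m)+\Delta_{\mathrm{ID}}c^{\mathrm{rg}}_i(P^{\mathrm{av}}_i-p^{\mathrm{reg}}_i)+\Delta_{\mathrm{ID}}\sum_{g\in\mathcal G_i}[c^{\mathrm g}_gp^{\mathrm g}_g+c^{\mathrm p}_gp^{\mathrm{pump}}_g+\tfrac{a_g}{2}(p^{\mathrm g}_g-p^{\mathrm{pump}}_g)^2]$ (arguments $t$ or $(t,m)$ suppressed), set $$f_i(x_i)=\sum_m\pi_m\sum_{t\in\mathcal T}\Big(\ell_i(t,m)+\sum_{e:\,i=\mathrm{from}(e)}c^{\mathrm{ls}}\ell_e(t,m)\Delta_{\mathrm{ID}}\Big)+\frac{w^{\mathrm{soc}}_i}{2}\sum_m\pi_m\sum_{t\in\mathcal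 T}(E_i(t+1,m)-E^{\mathrm{ref}}_i(t+1))^2+\frac{\varepsilon_i}{2}\|x_i\|^2 .$$ **Problem (ID).** For $a\in\{i\}\cup\mathcal N_i$ let $S_i^{(a)}\in\{0,1\}^{HM\times n_i}$ select the block $\theta_{a,i}\in\mathbb R^{HM}$ of $x_i$. Fix a reference area $r$. (ID) is: minimize $\sum_{i\in\mathcal N}f_i(x_i)$ over $\{x_i\}$ and $z_a\in\mathbb R^{HM}$ ($a\in\mathcal N$) subject to $x_i\in\mathcal X_i$, $S_i^{(a)}x_i=z_a$ for all $i\in\mathcal N$, $a\in\{i\}\cup\mathcal N_i$, and $z_r=0$. **Matrix representation.** $A_i=\operatorname{col}(A_{i,\mathrm{eq}},A_{i,\mathrm{in}})$ is the coefficient matrix of the constraints (1)--(11) defining $\mathcal X_i$, acting on $x_i$: $A_{i,\mathrm{eq}}$ has one row per scalar equality in (2), (3), (5), (6), (10), and the non-anticipativity condition (11) is represented by the $M-1$ vector equalities $u_i(0,m)-u_i(0,1)=0$, $m=2,\dots,M$; $A_{i,\mathrm{in}}$ has one row per scalar one-sided inequality, each two-sided inequality (including absolute-value bounds) being represented by its two one-sided inequalities. Battery states and line flows are retained as variables (their equations are not eliminated). The stacked matrices act on $v=\operatorname{col}((x_i)_i,(z_a)_a)$: $$A_{\mathrm{eq}}=\begin{bmatrix}\operatorname{blkdiag}_iA_{i,\mathrm{eq}}&\mathbf 0\\ \widehat S&-\widehat Z\\ \mathbf 0&Z_r\end{bmatrix},\qquad A_{\mathrm{in}}=[\operatorname{blkdiag}_iA_{i,\mathrm{in}}\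 \ \mathbf 0],$$ where $[\widehat S\ \ -\widehat Z]$ has one block row $S_i^{(a)}x_i-z_a$ for each $i\in\mathcal N$, $a\in\{i\}\cup\mathcal N_i$, and $Z_r$ selects $z_r$ from $\operatorname{col}_az_a$. **Centralized physical formulation.** The formulation with one angle $\theta_a(t,m)$ per area and one flow $p_e(t,m)=B_e(\theta_{\mathrm{from}(e)}-\theta_{\mathrm{to}(e)})$ per line, obtained from (ID) by replacing every copy $\theta_{a,i}$ (and $z_a$) by $\theta_a$ and both node copies $p^{\mathrm{flow}}_{e,i}$ by $p_e$ in all constraints and costs, with each line cost assigned once. *)

theory Defs
  imports "HOL-Analysis.Analysis" "HOL-Library.Landau_Symbols"
begin

section \<open>Matrices over explicit index sets, Hessians\<close>

definition nnz :: "'r set \<Rightarrow> 'c set \<Rightarrow> ('r \<Rightarrow> 'c \<Rightarrow> real) \<Rightarrow> nat" where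
  "nnz R C A = card {(r, c). r \<in> R \<and> c \<in> C \<and> A r c \<noteq> 0}"

definition mat_density :: "'r set \<Rightarrow> 'c set \<Rightarrow> ('r \<Rightarrow> 'c \<Rightarrow> real) \<Rightarrow> real" where
  "mat_density R C A = real (nnz R C A) / (real (card R) * real (card C))"

text \<open>The coefficient of the coordinate \<open>v\<close> in a homogeneous linear form \<open>L\<close>.\<close>

definition coef :: "(('v \<Rightarrow> real) \<Rightarrow> real) \<Rightarrow> 'v \<Rightarrow> real" where
  "coef L v = L (\<lambda>w. of_bool (w = v))"

definition partial :: "(('v \<Rightarrow> real) \<Rightarrow> real) \<Rightarrow> 'v \<Rightarrow> ('v \<Rightarrow> real) \<Rightarrow> real" where
  "partial f v x = deriv (\<lambda>s. f (x(v := s))) (x v)"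

definition hessian :: "(('v \<Rightarrow> real) \<Rightarrow> real) \<Rightarrow> ('v \<Rightarrow> real) \<Rightarrow> 'v \<Rightarrow> 'v \<Rightarrow> real" where
  "hessian f x u v = partial (partial f v) u x"


section \<open>Problem data\<close>

type_synonym line = "nat \<times> nat"

text \<open>
  A line is the oriented pair of its end points. Units and day-ahead hours are named by
  natural numbers. Argument order is area (or line, or unit), then stage or hour, then scenario.
  \<open>rem_qh h\<close> is the set of remaining quarter-hours of the hour \<open>h\<close>, numbered like the stages;
  some of them may lie beyond the horizon.
\<close>

record id_data =
  num_areas :: nat
  lines :: "line set"
  conv_areas :: "nat set"
  batt_areas :: "nat set"
  res_areas :: "nat set"
  units :: "nat set"
  place :: "nat \<Rightarrow> nat"
  horizon :: nat
  num_scen :: nat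
  prob :: "nat \<Rightarrow> real"
  ref_area :: nat
  P_mot :: "nat \<Rightarrow> nat \<Rightarrow> nat \<Rightarrow> real"
  P_av :: "nat \<Rightarrow> nat \<Rightarrow> nat \<Rightarrow> real"
  P_res_max :: "nat \<Rightarrow> nat \<Rightarrow> nat \<Rightarrow> real"
  Pg_max :: "nat \<Rightarrow> nat \<Rightarrow> nat \<Rightarrow> real"
  Pp_max :: "nat \<Rightarrow> nat \<Rightarrow> nat \<Rightarrow> real"
  B_line :: "line \<Rightarrow> real"
  P_line_max :: "line \<Rightarrow> real"
  num_cuts :: nat
  cut_a :: "line \<Rightarrow> nat \<Rightarrow> real"
  cut_b :: "line \<Rightarrow> nat \<Rightarrow> real"
  E_min :: "nat \<Rightarrow> real"
  E_max :: "nat \<Rightarrow> real"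
  Pb_max :: "nat \<Rightarrow> real"
  E_init :: "nat \<Rightarrow> real"
  E_term :: "nat \<Rightarrow> real"
  eta_c :: "nat \<Rightarrow> real"
  eta_d :: "nat \<Rightarrow> real"
  E_ref :: "nat \<Rightarrow> nat \<Rightarrow> real"
  Pcv_min :: "nat \<Rightarrow> real"
  Pcv_max :: "nat \<Rightarrow> real"
  ramp_max :: "nat \<Rightarrow> real"
  p_conv_prev :: "nat \<Rightarrow> real"
  peak_DA :: "nat \<Rightarrow> real"
  commit_DA :: "nat \<Rightarrow> nat \<Rightarrow> real"
  hours_DA :: "nat set"
  hour_of :: "nat \<Rightarrow> nat"
  e_DA :: "nat \<Rightarrow> nat \<Rightarrow> real"
  e_past :: "nat \<Rightarrow> nat \<Rightarrow> real"
  closed_hours :: "nat set"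
  rem_qh :: "nat \<Rightarrow> nat set"
  c_g :: "nat \<Rightarrow> nat \<Rightarrow> real"
  c_p :: "nat \<Rightarrow> nat \<Rightarrow> real"
  a_g :: "nat \<Rightarrow> nat \<Rightarrow> real"
  c_b :: "nat \<Rightarrow> real"
  c_ct :: "nat \<Rightarrow> real"
  c_rg :: "nat \<Rightarrow> real"
  c_pk :: real
  w_soc :: "nat \<Rightarrow> real"
  eps :: "nat \<Rightarrow> real"
  c_ls :: real
  c_E :: "nat \<Rightarrow> nat \<Rightarrow> real"
  c_Ex :: "nat \<Rightarrow> nat \<Rightarrow> real"

abbreviation areas :: "id_data \<Rightarrow> nat set" where
  "areas D \<equiv> {1..num_areas D}"

abbreviation stages :: "id_data \<Rightarrow> nat set" where
  "stages D \<equiv> {..<horizon D}"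

abbreviation scens :: "id_data \<Rightarrow> nat set" where
  "scens D \<equiv> {1..num_scen D}"

definition nbrs :: "id_data \<Rightarrow> nat \<Rightarrow> nat set" where
  "nbrs D i = {j. (i, j) \<in> lines D \<or> (j, i) \<in> lines D}"

definition inc_lines :: "id_data \<Rightarrow> nat \<Rightarrow> line set" where
  "inc_lines D i = {e \<in> lines D. fst e = i \<or> snd e = i}"

definition units_at :: "id_data \<Rightarrow> nat \<Rightarrow> nat set" where
  "units_at D i = {g \<in> units D. place D g = i}"

definition orient :: "nat \<Rightarrow> line \<Rightarrow> real" where
  "orient i e = (if i = fst e then 1 else - 1)"

definition other_end :: "nat \<Rightarrow> line \<Rightarrow> nat" where
  "other_end i e = (if i = fst e then snd e else fst e)"

definition stages_in_hour :: "id_data \<Rightarrow> nat \<Rightarrow> nat set" where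
  "stages_in_hour D h = {t \<in> stages D. hour_of D t = h}"

definition gate_hours :: "id_data \<Rightarrow> nat set" where
  "gate_hours D = {h \<in> closed_hours D. stages_in_hour D h \<noteq> {} \<and> rem_qh D h \<subseteq> stages D}"

definition Delta_ID :: real where
  "Delta_ID = 1 / 4"

definition id_instance :: "id_data \<Rightarrow> bool" where
  "id_instance D \<longleftrightarrow>
     lines D \<subseteq> areas D \<times> areas D \<and>
     (\<forall>i j. (i, j) \<in> lines D \<longrightarrow> i \<noteq> j \<and> (j, i) \<notin> lines D) \<and>
     conv_areas D \<subseteq> areas D \<and> batt_areas D \<subseteq> areas D \<and> res_areas D \<subseteq> areas D \<and>
     finite (units D) \<and> place D ` units D \<subseteq> areas D \<and>
     1 \<le> horizon D \<and> 1 \<le> num_scen D \<and>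
     (\<forall>m\<in>scens D. 0 < prob D m) \<and> (\<Sum>m\<in>scens D. prob D m) = 1 \<and>
     ref_area D \<in> areas D \<and>
     (\<forall>i\<in>areas D. \<forall>t\<in>stages D. \<forall>m\<in>scens D.
        0 \<le> P_mot D i t m \<and> 0 \<le> P_av D i t m \<and> 0 \<le> P_res_max D i t m) \<and>
     (\<forall>i\<in>areas D. \<forall>m\<in>scens D. \<forall>m'\<in>scens D.
        P_mot D i 0 m = P_mot D i 0 m' \<and> P_av D i 0 m = P_av D i 0 m' \<and>
        P_res_max D i 0 m = P_res_max D i 0 m') \<and>
     (\<forall>g\<in>units D. \<forall>m\<in>scens D. \<forall>m'\<in>scens D.
        Pg_max D g 0 m = Pg_max D g 0 m' \<and> Pp_max D g 0 m = Pp_max D g 0 m') \<and>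
     (\<forall>e\<in>lines D. 0 < B_line D e \<and> 0 < P_line_max D e) \<and>
     (\<forall>i\<in>batt_areas D. 0 < eta_c D i \<and> eta_c D i \<le> 1 \<and> 0 < eta_d D i \<and> eta_d D i \<le> 1) \<and>
     finite (hours_DA D) \<and> hour_of D ` stages D \<subseteq> hours_DA D \<and>
     closed_hours D \<subseteq> hours_DA D \<and>
     (\<forall>h\<in>hours_DA D. rem_qh D h \<inter> stages D = stages_in_hour D h) \<and>
     (\<forall>i\<in>conv_areas D. \<forall>h\<in>hours_DA D. commit_DA D i h \<in> {0, 1}) \<and>
     (\<forall>g\<in>units D. \<forall>t\<in>stages D. 0 \<le> c_g D g t \<and> 0 \<le> c_p D g t \<and> 0 \<le> a_g D g t) \<and>
     (\<forall>i\<in>areas D. 0 \<le> c_b D i \<and> 0 \<le> c_ct D i \<and> 0 \<le> c_rg D i \<and> 0 \<le> w_soc D i \<and> 0 \<le> eps D i) \<and>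
     0 \<le> c_pk D \<and> 0 < c_ls D"


section \<open>Local variables, feasible set and cost of an area\<close>

text \<open>
  Scalar coordinates of \<open>x\<^sub>i\<close>; \<open>Theta a\<close> is the copy of the angle of \<open>a\<close> held by the area
  (its own angle if \<open>a = i\<close>), \<open>Flow e\<close> its copy of the flow on \<open>e\<close>.
\<close>

datatype xvar =
    Pconv nat nat | Qpos nat nat | Qneg nat nat | Spk nat
  | Pch nat nat | Pdis nat nat | Soc nat nat
  | Pres nat nat | Preg nat nat
  | Pgen nat nat nat | Ppump nat nat nat
  | Theta nat nat nat | Flow line nat nat | Loss line nat nat

fun is_var :: "id_data \<Rightarrow> nat \<Rightarrow> xvar \<Rightarrow> bool" where
  "is_var D i (Pconv t m) \<longleftrightarrow> i \<in> conv_areas D \<and> t \<in> stages D \<and> m \<in> scens D"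
| "is_var D i (Qpos t m) \<longleftrightarrow> i \<in> conv_areas D \<and> t \<in> stages D \<and> m \<in> scens D"
| "is_var D i (Qneg t m) \<longleftrightarrow> i \<in> conv_areas D \<and> t \<in> stages D \<and> m \<in> scens D"
| "is_var D i (Spk m) \<longleftrightarrow> i \<in> conv_areas D \<and> m \<in> scens D"
| "is_var D i (Pch t m) \<longleftrightarrow> i \<in> batt_areas D \<and> t \<in> stages D \<and> m \<in> scens D"
| "is_var D i (Pdis t m) \<longleftrightarrow> i \<in> batt_areas D \<and> t \<in> stages D \<and> m \<in> scens D"
| "is_var D i (Soc s m) \<longleftrightarrow> i \<in> batt_areas D \<and> s \<in> {0..horizon D} \<and> m \<in> scens D"
| "is_var D i (Pres t m) \<longleftrightarrow> i \<in> res_areas D \<and> t \<in> stages D \<and> m \<in> scens D"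
| "is_var D i (Preg t m) \<longleftrightarrow> t \<in> stages D \<and> m \<in> scens D"
| "is_var D i (Pgen g t m) \<longleftrightarrow> g \<in> units_at D i \<and> t \<in> stages D \<and> m \<in> scens D"
| "is_var D i (Ppump g t m) \<longleftrightarrow> g \<in> units_at D i \<and> t \<in> stages D \<and> m \<in> scens D"
| "is_var D i (Theta a t m) \<longleftrightarrow> a \<in> insert i (nbrs D i) \<and> t \<in> stages D \<and> m \<in> scens D"
| "is_var D i (Flow e t m) \<longleftrightarrow> e \<in> inc_lines D i \<and> t \<in> stages D \<and> m \<in> scens D"
| "is_var D i (Loss e t m) \<longleftrightarrow> e \<in> lines D \<and> fst e = i \<and> t \<in> stages D \<and> m \<in> scens D"

definition xvars :: "id_data \<Rightarrow> nat \<Rightarrow> xvar set" where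
  "xvars D i = {v. is_var D i v}"

text \<open>Components of the control vector \<open>u\<^sub>i(t,m)\<close>.\<close>

datatype ctrl = U_conv | U_ch | U_dis | U_res | U_reg | U_gen nat | U_pump nat

fun ctrl_var :: "ctrl \<Rightarrow> nat \<Rightarrow> nat \<Rightarrow> xvar" where
  "ctrl_var U_conv t m = Pconv t m"
| "ctrl_var U_ch t m = Pch t m"
| "ctrl_var U_dis t m = Pdis t m"
| "ctrl_var U_res t m = Pres t m"
| "ctrl_var U_reg t m = Preg t m"
| "ctrl_var (U_gen g) t m = Pgen g t m"
| "ctrl_var (U_pump g) t m = Ppump g t m"

fun is_ctrl :: "id_data \<Rightarrow> nat \<Rightarrow> ctrl \<Rightarrow> bool" where
  "is_ctrl D i U_conv \<longleftrightarrow> i \<in> conv_areas D"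
| "is_ctrl D i U_ch \<longleftrightarrow> i \<in> batt_areas D"
| "is_ctrl D i U_dis \<longleftrightarrow> i \<in> batt_areas D"
| "is_ctrl D i U_res \<longleftrightarrow> i \<in> res_areas D"
| "is_ctrl D i U_reg \<longleftrightarrow> True"
| "is_ctrl D i (U_gen g) \<longleftrightarrow> g \<in> units_at D i"
| "is_ctrl D i (U_pump g) \<longleftrightarrow> g \<in> units_at D i"

definition injection :: "id_data \<Rightarrow> nat \<Rightarrow> nat \<Rightarrow> nat \<Rightarrow> (xvar \<Rightarrow> real) \<Rightarrow> real" where
  "injection D i t m x =
     (if i \<in> conv_areas D then x (Pconv t m) else 0)
     + (\<Sum>g\<in>units_at D i. x (Pgen g t m) - x (Ppump g t m))
     + (if i \<in> batt_areas D then x (Pdis t m) - x (Pch t m) else 0)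
     + (if i \<in> res_areas D then x (Pres t m) else 0)
     + x (Preg t m)
     - (\<Sum>e\<in>inc_lines D i. orient i e * x (Flow e t m))"

text \<open>The set \<open>\<X>\<^sub>i\<close>; coordinates outside \<open>xvars D i\<close> are not part of \<open>x\<^sub>i\<close> and never read.\<close>

definition local_feasible :: "id_data \<Rightarrow> nat \<Rightarrow> (xvar \<Rightarrow> real) set" where
  "local_feasible D i = {x.
     (\<forall>t\<in>stages D. \<forall>m\<in>scens D.
        0 \<le> x (Preg t m) \<and> x (Preg t m) \<le> P_av D i t m \<and>
        injection D i t m x = P_mot D i t m) \<and>
     (\<forall>e\<in>inc_lines D i. \<forall>t\<in>stages D. \<forall>m\<in>scens D.
        x (Flow e t m) = orient i e * B_line D e * (x (Theta i t m) - x (Theta (other_end i e) t m)) \<and>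
        \<bar>x (Flow e t m)\<bar> \<le> P_line_max D e) \<and>
     (\<forall>e\<in>lines D. fst e = i \<longrightarrow> (\<forall>k\<in>{1..num_cuts D}. \<forall>t\<in>stages D. \<forall>m\<in>scens D.
        x (Loss e t m) \<ge> cut_a D e k * x (Flow e t m) + cut_b D e k)) \<and>
     (i \<in> batt_areas D \<longrightarrow> (\<forall>m\<in>scens D.
        x (Soc 0 m) = E_init D i \<and>
        (\<forall>t\<in>stages D.
           x (Soc (t + 1) m) = x (Soc t m)
             + Delta_ID * (eta_c D i * x (Pch t m) - x (Pdis t m) / eta_d D i) \<and>
           0 \<le> x (Pch t m) \<and> x (Pch t m) \<le> Pb_max D i \<and>
           0 \<le> x (Pdis t m) \<and> x (Pdis t m) \<le> Pb_max D i) \<and>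
        (\<forall>s\<in>{0..horizon D}. E_min D i \<le> x (Soc s m) \<and> x (Soc s m) \<le> E_max D i) \<and>
        E_term D i \<le> x (Soc (horizon D) m))) \<and>
     (i \<in> conv_areas D \<longrightarrow> (\<forall>m\<in>scens D.
        (\<forall>t\<in>stages D.
           x (Pconv t m) = x (Qpos t m) - x (Qneg t m) \<and>
           0 \<le> x (Qpos t m) \<and> 0 \<le> x (Qneg t m) \<and>
           commit_DA D i (hour_of D t) * Pcv_min D i \<le> x (Pconv t m) \<and>
           x (Pconv t m) \<le> commit_DA D i (hour_of D t) * Pcv_max D i) \<and>
        \<bar>x (Pconv 0 m) - p_conv_prev D i\<bar> \<le> ramp_max D i \<and>
        (\<forall>t\<in>stages D. 1 \<le> t \<longrightarrow> \<bar>x (Pconv t m) - x (Pconv (t - 1) m)\<bar> \<le> ramp_max D i))) \<and>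
     (\<forall>g\<in>units_at D i. \<forall>t\<in>stages D. \<forall>m\<in>scens D.
        0 \<le> x (Pgen g t m) \<and> x (Pgen g t m) \<le> Pg_max D g t m \<and>
        0 \<le> x (Ppump g t m) \<and> x (Ppump g t m) \<le> Pp_max D g t m) \<and>
     (i \<in> res_areas D \<longrightarrow> (\<forall>t\<in>stages D. \<forall>m\<in>scens D.
        0 \<le> x (Pres t m) \<and> x (Pres t m) \<le> P_res_max D i t m)) \<and>
     (i \<in> conv_areas D \<longrightarrow> (\<forall>m\<in>scens D.
        (\<forall>t\<in>stages D. x (Spk m) \<ge> x (Qpos t m) - peak_DA D i) \<and> 0 \<le> x (Spk m))) \<and>
     (i \<in> conv_areas D \<longrightarrow> (\<forall>m\<in>scens D. \<forall>h\<in>gate_hours D.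
        Delta_ID * (\<Sum>t\<in>stages_in_hour D h. x (Pconv t m)) = e_DA D i h - e_past D i h)) \<and>
     (\<forall>c. is_ctrl D i c \<longrightarrow> (\<forall>m\<in>scens D. \<forall>m'\<in>scens D. x (ctrl_var c 0 m) = x (ctrl_var c 0 m')))}"

definition stage_cost :: "id_data \<Rightarrow> nat \<Rightarrow> (xvar \<Rightarrow> real) \<Rightarrow> nat \<Rightarrow> nat \<Rightarrow> real" where
  "stage_cost D i x t m =
     (if i \<in> conv_areas D
      then Delta_ID * (c_E D i t * x (Qpos t m) - c_Ex D i t * x (Qneg t m)) + c_pk D * x (Spk m)
      else 0)
     + (if i \<in> batt_areas D then Delta_ID * c_b D i * (x (Pch t m) + x (Pdis t m)) else 0)
     + (if i \<in> res_areas D then Delta_ID * c_ct D i * (P_res_max D i t m - x (Pres t m)) else 0)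
     + Delta_ID * c_rg D i * (P_av D i t m - x (Preg t m))
     + Delta_ID * (\<Sum>g\<in>units_at D i. c_g D g t * x (Pgen g t m) + c_p D g t * x (Ppump g t m)
          + a_g D g t / 2 * (x (Pgen g t m) - x (Ppump g t m))\<^sup>2)"

definition local_cost :: "id_data \<Rightarrow> nat \<Rightarrow> (xvar \<Rightarrow> real) \<Rightarrow> real" where
  "local_cost D i x =
     (\<Sum>m\<in>scens D. prob D m * (\<Sum>t\<in>stages D.
        stage_cost D i x t m + (\<Sum>e\<in>{e \<in> lines D. fst e = i}. c_ls D * x (Loss e t m) * Delta_ID)))
     + (if i \<in> batt_areas D
        then w_soc D i / 2 * (\<Sum>m\<in>scens D. prob D m *
               (\<Sum>t\<in>stages D. (x (Soc (t + 1) m) - E_ref D i (t + 1))\<^sup>2))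
        else 0)
     + eps D i / 2 * (\<Sum>v\<in>xvars D i. (x v)\<^sup>2)"

definition Q_loc :: "id_data \<Rightarrow> nat \<Rightarrow> (xvar \<Rightarrow> real) \<Rightarrow> xvar \<Rightarrow> xvar \<Rightarrow> real" where
  "Q_loc D i x = hessian (local_cost D i) x"


section \<open>Matrix representation of the local constraints\<close>

text \<open>
  Row labels. The two one-sided forms of \<open>l \<le> y \<le> u\<close> are \<open>- y \<le> - l\<close> (\<open>Lo\<close>) and
  \<open>y \<le> u\<close> (\<open>Up\<close>).
\<close>

datatype eq_row =
    Balance nat nat | FlowDef line nat nat
  | SocInit nat | SocDyn nat nat
  | ConvSplit nat nat | GateEnergy nat nat
  | NonAnt ctrl nat

datatype side = Lo | Up

datatype in_row =
    RegB side nat nat | FlowB side line nat nat | LossCut line nat nat nat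
  | SocB side nat nat | ChB side nat nat | DisB side nat nat | SocTerm nat
  | QposNN nat nat | QnegNN nat nat | ConvB side nat nat | RampB side nat nat
  | GenB side nat nat nat | PumpB side nat nat nat
  | ResB side nat nat | PeakCut nat nat | PeakNN nat

fun is_eq_row :: "id_data \<Rightarrow> nat \<Rightarrow> eq_row \<Rightarrow> bool" where
  "is_eq_row D i (Balance t m) \<longleftrightarrow> t \<in> stages D \<and> m \<in> scens D"
| "is_eq_row D i (FlowDef e t m) \<longleftrightarrow> e \<in> inc_lines D i \<and> t \<in> stages D \<and> m \<in> scens D"
| "is_eq_row D i (SocInit m) \<longleftrightarrow> i \<in> batt_areas D \<and> m \<in> scens D"
| "is_eq_row D i (SocDyn t m) \<longleftrightarrow> i \<in> batt_areas D \<and> t \<in> stages D \<and> m \<in> scens D"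
| "is_eq_row D i (ConvSplit t m) \<longleftrightarrow> i \<in> conv_areas D \<and> t \<in> stages D \<and> m \<in> scens D"
| "is_eq_row D i (GateEnergy h m) \<longleftrightarrow> i \<in> conv_areas D \<and> h \<in> gate_hours D \<and> m \<in> scens D"
| "is_eq_row D i (NonAnt c m) \<longleftrightarrow> is_ctrl D i c \<and> m \<in> {2..num_scen D}"

fun is_in_row :: "id_data \<Rightarrow> nat \<Rightarrow> in_row \<Rightarrow> bool" where
  "is_in_row D i (RegB b t m) \<longleftrightarrow> t \<in> stages D \<and> m \<in> scens D"
| "is_in_row D i (FlowB b e t m) \<longleftrightarrow> e \<in> inc_lines D i \<and> t \<in> stages D \<and> m \<in> scens D"
| "is_in_row D i (LossCut e k t m) \<longleftrightarrow>
     e \<in> lines D \<and> fst e = i \<and> k \<in> {1..num_cuts D} \<and> t \<in> stages D \<and> m \<in> scens D"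
| "is_in_row D i (SocB b s m) \<longleftrightarrow> i \<in> batt_areas D \<and> s \<in> {0..horizon D} \<and> m \<in> scens D"
| "is_in_row D i (ChB b t m) \<longleftrightarrow> i \<in> batt_areas D \<and> t \<in> stages D \<and> m \<in> scens D"
| "is_in_row D i (DisB b t m) \<longleftrightarrow> i \<in> batt_areas D \<and> t \<in> stages D \<and> m \<in> scens D"
| "is_in_row D i (SocTerm m) \<longleftrightarrow> i \<in> batt_areas D \<and> m \<in> scens D"
| "is_in_row D i (QposNN t m) \<longleftrightarrow> i \<in> conv_areas D \<and> t \<in> stages D \<and> m \<in> scens D"
| "is_in_row D i (QnegNN t m) \<longleftrightarrow> i \<in> conv_areas D \<and> t \<in> stages D \<and> m \<in> scens D"
| "is_in_row D i (ConvB b t m) \<longleftrightarrow> i \<in> conv_areas D \<and> t \<in> stages D \<and> m \<in> scens D"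
| "is_in_row D i (RampB b t m) \<longleftrightarrow> i \<in> conv_areas D \<and> t \<in> stages D \<and> m \<in> scens D"
| "is_in_row D i (GenB b g t m) \<longleftrightarrow> g \<in> units_at D i \<and> t \<in> stages D \<and> m \<in> scens D"
| "is_in_row D i (PumpB b g t m) \<longleftrightarrow> g \<in> units_at D i \<and> t \<in> stages D \<and> m \<in> scens D"
| "is_in_row D i (ResB b t m) \<longleftrightarrow> i \<in> res_areas D \<and> t \<in> stages D \<and> m \<in> scens D"
| "is_in_row D i (PeakCut t m) \<longleftrightarrow> i \<in> conv_areas D \<and> t \<in> stages D \<and> m \<in> scens D"
| "is_in_row D i (PeakNN m) \<longleftrightarrow> i \<in> conv_areas D \<and> m \<in> scens D"

fun eq_lhs :: "id_data \<Rightarrow> nat \<Rightarrow> eq_row \<Rightarrow> (xvar \<Rightarrow> real) \<Rightarrow> real" where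
  "eq_lhs D i (Balance t m) x = injection D i t m x"
| "eq_lhs D i (FlowDef e t m) x = x (Flow e t m)
     - orient i e * B_line D e * (x (Theta i t m) - x (Theta (other_end i e) t m))"
| "eq_lhs D i (SocInit m) x = x (Soc 0 m)"
| "eq_lhs D i (SocDyn t m) x = x (Soc (t + 1) m) - x (Soc t m)
     - Delta_ID * (eta_c D i * x (Pch t m) - x (Pdis t m) / eta_d D i)"
| "eq_lhs D i (ConvSplit t m) x = x (Pconv t m) - x (Qpos t m) + x (Qneg t m)"
| "eq_lhs D i (GateEnergy h m) x = Delta_ID * (\<Sum>t\<in>stages_in_hour D h. x (Pconv t m))"
| "eq_lhs D i (NonAnt c m) x = x (ctrl_var c 0 m) - x (ctrl_var c 0 1)"

fun eq_rhs :: "id_data \<Rightarrow> nat \<Rightarrow> eq_row \<Rightarrow> real" where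
  "eq_rhs D i (Balance t m) = P_mot D i t m"
| "eq_rhs D i (FlowDef e t m) = 0"
| "eq_rhs D i (SocInit m) = E_init D i"
| "eq_rhs D i (SocDyn t m) = 0"
| "eq_rhs D i (ConvSplit t m) = 0"
| "eq_rhs D i (GateEnergy h m) = e_DA D i h - e_past D i h"
| "eq_rhs D i (NonAnt c m) = 0"

fun sided :: "side \<Rightarrow> real \<Rightarrow> real" where
  "sided Lo y = - y"
| "sided Up y = y"

fun bnd :: "side \<Rightarrow> real \<Rightarrow> real \<Rightarrow> real" where
  "bnd Lo l u = - l"
| "bnd Up l u = u"

fun in_lhs :: "id_data \<Rightarrow> nat \<Rightarrow> in_row \<Rightarrow> (xvar \<Rightarrow> real) \<Rightarrow> real" where
  "in_lhs D i (RegB b t m) x = sided b (x (Preg t m))"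
| "in_lhs D i (FlowB b e t m) x = sided b (x (Flow e t m))"
| "in_lhs D i (LossCut e k t m) x = cut_a D e k * x (Flow e t m) - x (Loss e t m)"
| "in_lhs D i (SocB b s m) x = sided b (x (Soc s m))"
| "in_lhs D i (ChB b t m) x = sided b (x (Pch t m))"
| "in_lhs D i (DisB b t m) x = sided b (x (Pdis t m))"
| "in_lhs D i (SocTerm m) x = - x (Soc (horizon D) m)"
| "in_lhs D i (QposNN t m) x = - x (Qpos t m)"
| "in_lhs D i (QnegNN t m) x = - x (Qneg t m)"
| "in_lhs D i (ConvB b t m) x = sided b (x (Pconv t m))"
| "in_lhs D i (RampB b t m) x =
     sided b (x (Pconv t m) - (if t = 0 then 0 else x (Pconv (t - 1) m)))"
| "in_lhs D i (GenB b g t m) x = sided b (x (Pgen g t m))"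
| "in_lhs D i (PumpB b g t m) x = sided b (x (Ppump g t m))"
| "in_lhs D i (ResB b t m) x = sided b (x (Pres t m))"
| "in_lhs D i (PeakCut t m) x = x (Qpos t m) - x (Spk m)"
| "in_lhs D i (PeakNN m) x = - x (Spk m)"

fun in_rhs :: "id_data \<Rightarrow> nat \<Rightarrow> in_row \<Rightarrow> real" where
  "in_rhs D i (RegB b t m) = bnd b 0 (P_av D i t m)"
| "in_rhs D i (FlowB b e t m) = bnd b (- P_line_max D e) (P_line_max D e)"
| "in_rhs D i (LossCut e k t m) = - cut_b D e k"
| "in_rhs D i (SocB b s m) = bnd b (E_min D i) (E_max D i)"
| "in_rhs D i (ChB b t m) = bnd b 0 (Pb_max D i)"
| "in_rhs D i (DisB b t m) = bnd b 0 (Pb_max D i)"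
| "in_rhs D i (SocTerm m) = - E_term D i"
| "in_rhs D i (QposNN t m) = 0"
| "in_rhs D i (QnegNN t m) = 0"
| "in_rhs D i (ConvB b t m) =
     bnd b (commit_DA D i (hour_of D t) * Pcv_min D i) (commit_DA D i (hour_of D t) * Pcv_max D i)"
| "in_rhs D i (RampB b t m) =
     (let p = if t = 0 then p_conv_prev D i else 0 in bnd b (p - ramp_max D i) (p + ramp_max D i))"
| "in_rhs D i (GenB b g t m) = bnd b 0 (Pg_max D g t m)"
| "in_rhs D i (PumpB b g t m) = bnd b 0 (Pp_max D g t m)"
| "in_rhs D i (ResB b t m) = bnd b 0 (P_res_max D i t m)"
| "in_rhs D i (PeakCut t m) = peak_DA D i"
| "in_rhs D i (PeakNN m) = 0"

definition eq_rows :: "id_data \<Rightarrow> nat \<Rightarrow> eq_row set" where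
  "eq_rows D i = {r. is_eq_row D i r}"

definition in_rows :: "id_data \<Rightarrow> nat \<Rightarrow> in_row set" where
  "in_rows D i = {r. is_in_row D i r}"

definition A_eq :: "id_data \<Rightarrow> nat \<Rightarrow> eq_row \<Rightarrow> xvar \<Rightarrow> real" where
  "A_eq D i r = coef (eq_lhs D i r)"

definition A_in :: "id_data \<Rightarrow> nat \<Rightarrow> in_row \<Rightarrow> xvar \<Rightarrow> real" where
  "A_in D i r = coef (in_lhs D i r)"

definition loc_rows :: "id_data \<Rightarrow> nat \<Rightarrow> (eq_row + in_row) set" where
  "loc_rows D i = eq_rows D i <+> in_rows D i"

definition A_loc :: "id_data \<Rightarrow> nat \<Rightarrow> eq_row + in_row \<Rightarrow> xvar \<Rightarrow> real" where
  "A_loc D i = case_sum (A_eq D i) (A_in D i)"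

definition linear_form :: "'v set \<Rightarrow> (('v \<Rightarrow> real) \<Rightarrow> real) \<Rightarrow> bool" where
  "linear_form V L \<longleftrightarrow> (\<forall>x. L x = (\<Sum>v\<in>V. coef L v * x v))"

lemma linear_form_coord:
  assumes "finite V" "v \<in> V"
  shows "linear_form V (\<lambda>x. x v)"
  unfolding linear_form_def coef_def
proof
  fix x :: "'a \<Rightarrow> real"
  have "(\<Sum>w\<in>V. of_bool (v = w) * x w) = (\<Sum>w\<in>V. if v = w then x w else 0)"
    by (rule sum.cong) simp_all
  then show "x v = (\<Sum>w\<in>V. of_bool (v = w) * x w)"
    using assms by simp
qed

lemma linear_form_zero: "linear_form V (\<lambda>x. 0)"
  unfolding linear_form_def coef_def by simp

lemma linear_form_scale:
  assumes "linear_form V L"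
  shows "linear_form V (\<lambda>x. c * L x)"
  unfolding linear_form_def
proof
  fix x
  have "L x = (\<Sum>v\<in>V. coef L v * x v)" using assms unfolding linear_form_def by (rule spec)
  then have "c * L x = (\<Sum>v\<in>V. c * (coef L v * x v))" by (simp only: sum_distrib_left)
  then show "c * L x = (\<Sum>v\<in>V. coef (\<lambda>x. c * L x) v * x v)" by (simp only: coef_def mult.assoc)
qed

lemma linear_form_add:
  assumes "linear_form V L" "linear_form V L'"
  shows "linear_form V (\<lambda>x. L x + L' x)"
  unfolding linear_form_def
proof
  fix x
  have "L x = (\<Sum>v\<in>V. coef L v * x v)" using assms(1) unfolding linear_form_def by (rule spec)
  moreover have "L' x = (\<Sum>v\<in>V. coef L' v * x v)" using assms(2) unfolding linear_form_def by (rule spec)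
  ultimately have "L x + L' x = (\<Sum>v\<in>V. (coef L v + coef L' v) * x v)"
    by (simp only: distrib_right sum.distrib)
  then show "L x + L' x = (\<Sum>v\<in>V. coef (\<lambda>x. L x + L' x) v * x v)" by (simp only: coef_def)
qed

lemma linear_form_uminus: "linear_form V L \<Longrightarrow> linear_form V (\<lambda>x. - L x)"
  using linear_form_scale[of V L "-1"] by (simp only: mult_minus1)

lemma linear_form_diff: "linear_form V L \<Longrightarrow> linear_form V L' \<Longrightarrow> linear_form V (\<lambda>x. L x - L' x)"
  using linear_form_add[of V L "\<lambda>x. - L' x"] linear_form_uminus[of V L'] by simp

lemma linear_form_divide: "linear_form V L \<Longrightarrow> linear_form V (\<lambda>x. L x / c)"
  using linear_form_scale[of V L "1/c"] by simp

lemma linear_form_if: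
  "(b \<Longrightarrow> linear_form V L) \<Longrightarrow> (\<not> b \<Longrightarrow> linear_form V L') \<Longrightarrow> linear_form V (\<lambda>x. if b then L x else L' x)"
  by (cases b) auto

lemma linear_form_sum:
  "(\<And>a. a \<in> I \<Longrightarrow> linear_form V (L a)) \<Longrightarrow> linear_form V (\<lambda>x. \<Sum>a\<in>I. L a x)"
proof (induction I rule: infinite_finite_induct)
  case (insert a I)
  then have "linear_form V (\<lambda>x. L a x + (\<Sum>a\<in>I. L a x))"
    by (intro linear_form_add) simp_all
  with insert.hyps show ?case by simp
qed (simp_all add: linear_form_zero)

lemma linear_form_sided: "linear_form V L \<Longrightarrow> linear_form V (\<lambda>x. sided b (L x))"
  using linear_form_uminus[of V L] by (cases b) simp_all

lemmas linear_form_intros = linear_form_zero linear_form_scale linear_form_add linear_form_diff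
  linear_form_uminus linear_form_divide linear_form_if linear_form_sum linear_form_sided
  linear_form_coord


lemma id_instance_finite:
  assumes "id_instance D"
  shows "finite (lines D)" "finite (units D)" "0 < horizon D" "1 \<le> num_scen D"
proof -
  note a = assms[unfolded id_instance_def]
  show "finite (lines D)" by (rule finite_subset[OF a[THEN conjunct1]]) simp
  show "finite (units D)" by (rule a[THEN conjunct2, THEN conjunct2, THEN conjunct2, THEN conjunct2, THEN conjunct2, THEN conjunct1])
  show "1 \<le> num_scen D" by (rule a[THEN conjunct2, THEN conjunct2, THEN conjunct2, THEN conjunct2, THEN conjunct2, THEN conjunct2, THEN conjunct2, THEN conjunct2, THEN conjunct1])
  have "1 \<le> horizon D" by (rule a[THEN conjunct2, THEN conjunct2, THEN conjunct2, THEN conjunct2, THEN conjunct2, THEN conjunct2, THEN conjunct2, THEN conjunct1])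
  then show "0 < horizon D" by simp
qed

lemma finite_xvars:
  assumes "id_instance D"
  shows "finite (xvars D i)"
proof -
  let ?TM = "{0..horizon D} \<times> scens D"
  have L: "finite (lines D)" and U: "finite (units D)"
    using id_instance_finite[OF assms] by blast+
  have N: "finite (insert i (nbrs D i))"
  proof -
    have "nbrs D i \<subseteq> fst ` lines D \<union> snd ` lines D" by (force simp: nbrs_def)
    then have "finite (nbrs D i)" by (rule finite_subset) (simp add: L)
    then show ?thesis by simp
  qed
  let ?S = "(\<lambda>(t, m). Pconv t m) ` ?TM
    \<union> (\<lambda>(t, m). Qpos t m) ` ?TM
    \<union> (\<lambda>(t, m). Qneg t m) ` ?TM
    \<union> (\<lambda>(t, m). Pch t m) ` ?TM
    \<union> (\<lambda>(t, m). Pdis t m) ` ?TM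
    \<union> (\<lambda>(t, m). Soc t m) ` ?TM
    \<union> (\<lambda>(t, m). Pres t m) ` ?TM
    \<union> (\<lambda>(t, m). Preg t m) ` ?TM
    \<union> Spk ` scens D
    \<union> (\<lambda>(g, t, m). Pgen g t m) ` (units D \<times> ?TM)
    \<union> (\<lambda>(g, t, m). Ppump g t m) ` (units D \<times> ?TM)
    \<union> (\<lambda>(g, t, m). Theta g t m) ` (insert i (nbrs D i) \<times> ?TM)
    \<union> (\<lambda>(g, t, m). Flow g t m) ` (lines D \<times> ?TM)
    \<union> (\<lambda>(g, t, m). Loss g t m) ` (lines D \<times> ?TM)"
  have "v \<in> ?S" if "v \<in> xvars D i" for v
    using that by (cases v) (auto simp: xvars_def units_at_def inc_lines_def image_def)
  moreover have "finite ?S"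
    using L U N by auto
  ultimately show ?thesis by (rule finite_subset[OF subsetI])
qed


lemma linear_form_eq_lhs:
  assumes D: "id_instance D" and r: "r \<in> eq_rows D i"
  shows "linear_form (xvars D i) (eq_lhs D i r)"
proof -
  have fin: "finite (Collect (is_var D i))" using finite_xvars[OF D] unfolding xvars_def .
  have T: "0 < horizon D" "1 \<le> num_scen D" using id_instance_finite[OF D] by simp_all
  have oe: "other_end i e \<in> nbrs D i" if "e \<in> inc_lines D i" for e
    using that by (cases e) (auto simp: other_end_def inc_lines_def nbrs_def)
  show ?thesis
  proof (cases r)
    case (NonAnt c m)
    then show ?thesis using r T
      by (cases c) (auto intro!: linear_form_intros fin simp: eq_lhs.simps[abs_def] eq_rows_def xvars_def)
  qed (use r T oe in \<open>auto intro!: linear_form_intros fin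
        simp: eq_lhs.simps[abs_def] eq_rows_def xvars_def injection_def stages_in_hour_def\<close>)
qed

lemma linear_form_in_lhs:
  assumes D: "id_instance D" and r: "r \<in> in_rows D i"
  shows "linear_form (xvars D i) (in_lhs D i r)"
proof -
  have fin: "finite (Collect (is_var D i))" using finite_xvars[OF D] unfolding xvars_def .
  have inc: "(i, b) \<in> inc_lines D i" if "(i, b) \<in> lines D" for b
    using that by (simp add: inc_lines_def)
  show ?thesis using r
    by (cases r) (auto intro!: linear_form_intros fin inc simp: in_lhs.simps[abs_def] in_rows_def xvars_def)
qed


lemma nonant_iff:
  "1 \<le> (M::nat) \<Longrightarrow> (\<forall>m\<in>{2..M}. f m - f 1 = (0::real)) \<longleftrightarrow> (\<forall>m\<in>{1..M}. \<forall>m'\<in>{1..M}. f m = f m')"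
proof
  assume M: "1 \<le> M" and "\<forall>m\<in>{2..M}. f m - f 1 = 0"
  then have "f m = f 1" if "m \<in> {1..M}" for m
    using that by (cases "m = 1") auto
  then show "\<forall>m\<in>{1..M}. \<forall>m'\<in>{1..M}. f m = f m'" by metis
qed auto


lemma local_feasible_rowsD:
  assumes D: "id_instance D" and x: "x \<in> local_feasible D i"
  shows "r \<in> eq_rows D i \<Longrightarrow> eq_lhs D i r x = eq_rhs D i r"
    and "s \<in> in_rows D i \<Longrightarrow> in_lhs D i s x \<le> in_rhs D i s"
proof -
  have T: "0 < horizon D" and M: "1 \<le> num_scen D" using id_instance_finite[OF D] by simp_all
  note F = x[unfolded local_feasible_def mem_Collect_eq]
  note f = F[THEN conjunct1]
    F[THEN conjunct2, THEN conjunct1]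
    F[THEN conjunct2, THEN conjunct2, THEN conjunct1]
    F[THEN conjunct2, THEN conjunct2, THEN conjunct2, THEN conjunct1]
    F[THEN conjunct2, THEN conjunct2, THEN conjunct2, THEN conjunct2, THEN conjunct1]
    F[THEN conjunct2, THEN conjunct2, THEN conjunct2, THEN conjunct2, THEN conjunct2, THEN conjunct1]
    F[THEN conjunct2, THEN conjunct2, THEN conjunct2, THEN conjunct2, THEN conjunct2, THEN conjunct2, THEN conjunct1]
    F[THEN conjunct2, THEN conjunct2, THEN conjunct2, THEN conjunct2, THEN conjunct2, THEN conjunct2, THEN conjunct2, THEN conjunct1]
    F[THEN conjunct2, THEN conjunct2, THEN conjunct2, THEN conjunct2, THEN conjunct2, THEN conjunct2, THEN conjunct2, THEN conjunct2, THEN conjunct1]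
  note na = F[THEN conjunct2, THEN conjunct2, THEN conjunct2, THEN conjunct2, THEN conjunct2, THEN conjunct2, THEN conjunct2, THEN conjunct2, THEN conjunct2]
  show "eq_lhs D i r x = eq_rhs D i r" if "r \<in> eq_rows D i"
  proof (cases r)
    case (NonAnt c m)
    then have "is_ctrl D i c" "m \<in> scens D" "1 \<in> scens D" using that M by (simp_all add: eq_rows_def)
    then have "x (ctrl_var c 0 m) = x (ctrl_var c 0 1)" using na by blast
    then show ?thesis using NonAnt by simp
  next
    case (SocDyn t m)
    then have "x (Soc (t + 1) m) = x (Soc t m)
      + Delta_ID * (eta_c D i * x (Pch t m) - x (Pdis t m) / eta_d D i)"
      using that f(4) by (simp add: eq_rows_def)
    then show ?thesis using SocDyn by simp
  next
    case (GateEnergy h m)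
    then have "i \<in> conv_areas D" "h \<in> gate_hours D" "m \<in> scens D" using that by (simp_all add: eq_rows_def)
    then show ?thesis using f(9) GateEnergy by simp
  next
    case (FlowDef e t m)
    then have "e \<in> inc_lines D i" "t \<in> stages D" "m \<in> scens D" using that by (simp_all add: eq_rows_def)
    then show ?thesis using f(2)[rule_format, of e t m] FlowDef by simp
  next
    case (ConvSplit t m)
    then have "i \<in> conv_areas D" "t \<in> stages D" "m \<in> scens D" using that by (simp_all add: eq_rows_def)
    then show ?thesis using f(5) ConvSplit by simp
  next
    case (Balance t m)
    then show ?thesis using that f(1) by (simp add: eq_rows_def)
  next
    case (SocInit m)
    then show ?thesis using that f(4) by (simp add: eq_rows_def)
  qed
  show "in_lhs D i s x \<le> in_rhs D i s" if "s \<in> in_rows D i"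
  proof (cases s)
    case (RegB b t m)
    then have "t \<in> stages D" "m \<in> scens D"  using that by (simp_all add: in_rows_def)
    then have "0 \<le> x (Preg t m) \<and> x (Preg t m) \<le> P_av D i t m"
      using f(1) by blast
    then show ?thesis using RegB by (cases b) (simp_all only: in_lhs.simps in_rhs.simps sided.simps bnd.simps neg_le_iff_le)
  next
    case (FlowB b e t m)
    then have "e \<in> inc_lines D i" "t \<in> stages D" "m \<in> scens D" using that by (simp_all add: in_rows_def)
    then have "\<bar>x (Flow e t m)\<bar> \<le> P_line_max D e" using f(2) by blast
    then show ?thesis using FlowB by (cases b) (simp_all add: abs_le_iff)
  next
    case (LossCut e k t m) then show ?thesis using that f(3) by (simp add: in_rows_def algebra_simps)
  next
    case (SocB b t m) then show ?thesis using that f(4) by (cases b) (simp_all add: in_rows_def)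
  next
    case (ChB b t m) then show ?thesis using that f(4) by (cases b) (simp_all add: in_rows_def)
  next
    case (DisB b t m) then show ?thesis using that f(4) by (cases b) (simp_all add: in_rows_def)
  next
    case (ConvB b t m)
    then have "t \<in> stages D" "m \<in> scens D" "i \<in> conv_areas D" using that by (simp_all add: in_rows_def)
    then have "commit_DA D i (hour_of D t) * Pcv_min D i \<le> x (Pconv t m) \<and> x (Pconv t m) \<le> commit_DA D i (hour_of D t) * Pcv_max D i"
      using f(5) by blast
    then show ?thesis using ConvB by (cases b) (simp_all only: in_lhs.simps in_rhs.simps sided.simps bnd.simps neg_le_iff_le)
  next
    case (GenB b g t m) then show ?thesis using that f(6) by (cases b) (simp_all add: in_rows_def)
  next
    case (PumpB b g t m) then show ?thesis using that f(6) by (cases b) (simp_all add: in_rows_def)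
  next
    case (ResB b t m) then show ?thesis using that f(7) by (cases b) (simp_all add: in_rows_def)
  next
    case (RampB b t m)
    then have tm: "i \<in> conv_areas D" "t \<in> stages D" "m \<in> scens D" using that by (simp_all add: in_rows_def)
    show ?thesis
    proof (cases "t = 0")
      case True
      have "\<bar>x (Pconv 0 m) - p_conv_prev D i\<bar> \<le> ramp_max D i" using f(5) tm by blast
      then show ?thesis using True RampB by (cases b) (simp_all add: abs_le_iff)
    next
      case False
      then have "1 \<le> t" by simp
      then have "\<bar>x (Pconv t m) - x (Pconv (t - 1) m)\<bar> \<le> ramp_max D i" using f(5) tm by blast
      then show ?thesis using False RampB by (cases b) (simp_all add: abs_le_iff)
    qed
  next
    case (PeakCut t m)
    then have "x (Spk m) \<ge> x (Qpos t m) - peak_DA D i" using that f(8) by (simp add: in_rows_def)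
    then show ?thesis using PeakCut by simp
  next
    case (SocTerm m) then show ?thesis using that f(4) by (simp add: in_rows_def)
  next
    case (QposNN t m) then show ?thesis using that f(5) by (simp add: in_rows_def)
  next
    case (QnegNN t m) then show ?thesis using that f(5) by (simp add: in_rows_def)
  next
    case (PeakNN m) then show ?thesis using that f(8) by (simp add: in_rows_def)
  qed
qed


lemma local_feasible_rowsI:
  assumes D: "id_instance D"
    and E: "\<And>r. r \<in> eq_rows D i \<Longrightarrow> eq_lhs D i r x = eq_rhs D i r"
    and I: "\<And>s. s \<in> in_rows D i \<Longrightarrow> in_lhs D i s x \<le> in_rhs D i s"
  shows "x \<in> local_feasible D i"
proof -
  have T: "0 \<in> stages D" and M: "1 \<le> num_scen D" using id_instance_finite[OF D] by simp_all
  have E': "is_eq_row D i r \<Longrightarrow> eq_lhs D i r x = eq_rhs D i r" for r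
    using E by (simp add: eq_rows_def)
  have I': "is_in_row D i r \<Longrightarrow> in_lhs D i r x \<le> in_rhs D i r" for r
    using I by (simp add: in_rows_def)
  have bal: "injection D i t m x = P_mot D i t m" if "t \<in> stages D" "m \<in> scens D" for t m
    using E'[of "Balance t m"] that by simp
  have fdef: "x (Flow f t m) =
      orient i f * B_line D f * (x (Theta i t m) - x (Theta (other_end i f) t m))"
    if "f \<in> inc_lines D i" "t \<in> stages D" "m \<in> scens D" for f t m
    using E'[of "FlowDef f t m"] that by simp
  have soc0: "x (Soc 0 m) = E_init D i" if "i \<in> batt_areas D" "m \<in> scens D" for m
    using E'[of "SocInit m"] that by simp
  have dyn: "x (Soc (t + 1) m) = x (Soc t m)
      + Delta_ID * (eta_c D i * x (Pch t m) - x (Pdis t m) / eta_d D i)"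
    if "i \<in> batt_areas D" "t \<in> stages D" "m \<in> scens D" for t m
    using E'[of "SocDyn t m"] that by simp
  have spl: "x (Pconv t m) = x (Qpos t m) - x (Qneg t m)"
    if "i \<in> conv_areas D" "t \<in> stages D" "m \<in> scens D" for t m
    using E'[of "ConvSplit t m"] that by simp
  have gate: "Delta_ID * (\<Sum>t\<in>stages_in_hour D h. x (Pconv t m)) = e_DA D i h - e_past D i h"
    if "i \<in> conv_areas D" "h \<in> gate_hours D" "m \<in> scens D" for h m
    using E'[of "GateEnergy h m"] that by simp
  have reg: "0 \<le> x (Preg t m)" "x (Preg t m) \<le> P_av D i t m"
    if "t \<in> stages D" "m \<in> scens D" for t m
    using I'[of "RegB Lo t m"] I'[of "RegB Up t m"] that by simp_all
  have soc: "E_min D i \<le> x (Soc t m)" "x (Soc t m) \<le> E_max D i"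
    if "i \<in> batt_areas D" "t \<in> {0..horizon D}" "m \<in> scens D" for t m
    using I'[of "SocB Lo t m"] I'[of "SocB Up t m"] that by simp_all
  have bat: "0 \<le> x (Pch t m)" "x (Pch t m) \<le> Pb_max D i" "0 \<le> x (Pdis t m)" "x (Pdis t m) \<le> Pb_max D i"
    if "i \<in> batt_areas D" "t \<in> stages D" "m \<in> scens D" for t m
    using I'[of "ChB Lo t m"] I'[of "ChB Up t m"] I'[of "DisB Lo t m"] I'[of "DisB Up t m"] that
    by simp_all
  have trm: "E_term D i \<le> x (Soc (horizon D) m)" if "i \<in> batt_areas D" "m \<in> scens D" for m
    using I'[of "SocTerm m"] that by simp
  have cv: "0 \<le> x (Qpos t m)" "0 \<le> x (Qneg t m)"
      "commit_DA D i (hour_of D t) * Pcv_min D i \<le> x (Pconv t m)"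
      "x (Pconv t m) \<le> commit_DA D i (hour_of D t) * Pcv_max D i"
    if "i \<in> conv_areas D" "t \<in> stages D" "m \<in> scens D" for t m
    using I'[of "QposNN t m"] I'[of "QnegNN t m"] I'[of "ConvB Lo t m"] I'[of "ConvB Up t m"] that
    by simp_all
  have gen: "0 \<le> x (Pgen g t m)" "x (Pgen g t m) \<le> Pg_max D g t m"
      "0 \<le> x (Ppump g t m)" "x (Ppump g t m) \<le> Pp_max D g t m"
    if "g \<in> units_at D i" "t \<in> stages D" "m \<in> scens D" for g t m
    using I'[of "GenB Lo g t m"] I'[of "GenB Up g t m"] I'[of "PumpB Lo g t m"] I'[of "PumpB Up g t m"] that
    by simp_all
  have res: "0 \<le> x (Pres t m)" "x (Pres t m) \<le> P_res_max D i t m"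
    if "i \<in> res_areas D" "t \<in> stages D" "m \<in> scens D" for t m
    using I'[of "ResB Lo t m"] I'[of "ResB Up t m"] that by simp_all
  have pk0: "0 \<le> x (Spk m)" if "i \<in> conv_areas D" "m \<in> scens D" for m
    using I'[of "PeakNN m"] that by simp
  have flow: "\<bar>x (Flow f t m)\<bar> \<le> P_line_max D f"
    if "f \<in> inc_lines D i" "t \<in> stages D" "m \<in> scens D" for f t m
    using I'[of "FlowB Lo f t m"] I'[of "FlowB Up f t m"] that by (simp add: abs_le_iff)
  have cut: "x (Loss f t m) \<ge> cut_a D f k * x (Flow f t m) + cut_b D f k"
    if "f \<in> lines D" "fst f = i" "k \<in> {1..num_cuts D}" "t \<in> stages D" "m \<in> scens D" for f k t m
    using I'[of "LossCut f k t m"] that by simp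
  have ramp0: "\<bar>x (Pconv 0 m) - p_conv_prev D i\<bar> \<le> ramp_max D i"
    if "i \<in> conv_areas D" "m \<in> scens D" for m
    using I'[of "RampB Lo 0 m"] I'[of "RampB Up 0 m"] that T by (simp add: abs_le_iff)
  have ramp: "\<bar>x (Pconv t m) - x (Pconv (t - 1) m)\<bar> \<le> ramp_max D i"
    if "i \<in> conv_areas D" "t \<in> stages D" "m \<in> scens D" "1 \<le> t" for t m
    using I'[of "RampB Lo t m"] I'[of "RampB Up t m"] that by (simp add: abs_le_iff)
  have pk: "x (Spk m) \<ge> x (Qpos t m) - peak_DA D i"
    if "i \<in> conv_areas D" "t \<in> stages D" "m \<in> scens D" for t m
    using I'[of "PeakCut t m"] that by simp
  have na: "\<forall>m\<in>scens D. \<forall>m'\<in>scens D. x (ctrl_var c 0 m) = x (ctrl_var c 0 m')" if "is_ctrl D i c" for c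
  proof -
    have "\<forall>m\<in>{2..num_scen D}. x (ctrl_var c 0 m) - x (ctrl_var c 0 1) = 0"
      using E'[of "NonAnt c _"] that by simp
    then show ?thesis using nonant_iff[OF M, of "\<lambda>m. x (ctrl_var c 0 m)"] by blast
  qed
  show ?thesis
    unfolding local_feasible_def mem_Collect_eq
    by (intro conjI ballI impI allI)
      (rule bal fdef soc0 dyn spl gate reg soc bat trm cv gen res pk0 flow cut ramp0 ramp pk
        na[rule_format]; assumption)+
qed


lemma local_feasible_iff_rows:
  assumes D: "id_instance D"
  shows "x \<in> local_feasible D i \<longleftrightarrow>
    (\<forall>r\<in>eq_rows D i. (\<Sum>v\<in>xvars D i. A_eq D i r v * x v) = eq_rhs D i r) \<and>
    (\<forall>r\<in>in_rows D i. (\<Sum>v\<in>xvars D i. A_in D i r v * x v) \<le> in_rhs D i r)"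
proof -
  have "(\<Sum>v\<in>xvars D i. A_eq D i r v * x v) = eq_lhs D i r x" if "r \<in> eq_rows D i" for r
    unfolding A_eq_def
    by (rule sym, rule linear_form_eq_lhs[OF D that, unfolded linear_form_def, THEN spec])
  moreover have "(\<Sum>v\<in>xvars D i. A_in D i r v * x v) = in_lhs D i r x" if "r \<in> in_rows D i" for r
    unfolding A_in_def
    by (rule sym, rule linear_form_in_lhs[OF D that, unfolded linear_form_def, THEN spec])
  ultimately show ?thesis
    using local_feasible_rowsD[OF D, of x i] local_feasible_rowsI[OF D, of i x] by (simp cong: ball_cong) blast
qed


section \<open>The problem (ID) and its stacked matrices\<close>

definition ID_feasible :: "id_data \<Rightarrow> (nat \<Rightarrow> xvar \<Rightarrow> real) \<Rightarrow> (nat \<Rightarrow> nat \<Rightarrow> nat \<Rightarrow> real) \<Rightarrow> bool" where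
  "ID_feasible D x z \<longleftrightarrow>
     (\<forall>i\<in>areas D. x i \<in> local_feasible D i) \<and>
     (\<forall>i\<in>areas D. \<forall>a\<in>insert i (nbrs D i). \<forall>t\<in>stages D. \<forall>m\<in>scens D.
        x i (Theta a t m) = z a t m) \<and>
     (\<forall>t\<in>stages D. \<forall>m\<in>scens D. z (ref_area D) t m = 0)"

definition ID_cost :: "id_data \<Rightarrow> (nat \<Rightarrow> xvar \<Rightarrow> real) \<Rightarrow> real" where
  "ID_cost D x = (\<Sum>i\<in>areas D. local_cost D i (x i))"

definition ID_solution :: "id_data \<Rightarrow> (nat \<Rightarrow> xvar \<Rightarrow> real) \<Rightarrow> (nat \<Rightarrow> nat \<Rightarrow> nat \<Rightarrow> real) \<Rightarrow> bool" where
  "ID_solution D x z \<longleftrightarrow> ID_feasible D x z \<and> (\<forall>x' z'. ID_feasible D x' z' \<longrightarrow> ID_cost D x \<le> ID_cost D x')"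

datatype scol = XCol nat xvar | ZCol nat nat nat

datatype srow = LocEq nat eq_row | Cons nat nat nat nat | Ref nat nat | LocIn nat in_row

definition stack_cols :: "id_data \<Rightarrow> scol set" where
  "stack_cols D = {XCol i v | i v. i \<in> areas D \<and> v \<in> xvars D i}
     \<union> {ZCol a t m | a t m. a \<in> areas D \<and> t \<in> stages D \<and> m \<in> scens D}"

definition stack_rows :: "id_data \<Rightarrow> srow set" where
  "stack_rows D = {LocEq i r | i r. i \<in> areas D \<and> r \<in> eq_rows D i}
     \<union> {Cons i a t m | i a t m. i \<in> areas D \<and> a \<in> insert i (nbrs D i) \<and> t \<in> stages D \<and> m \<in> scens D}
     \<union> {Ref t m | t m. t \<in> stages D \<and> m \<in> scens D}
     \<union> {LocIn i r | i r. i \<in> areas D \<and> r \<in> in_rows D i}"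

fun A_stack :: "id_data \<Rightarrow> srow \<Rightarrow> scol \<Rightarrow> real" where
  "A_stack D (LocEq i r) (XCol j v) = (if j = i then A_eq D i r v else 0)"
| "A_stack D (LocEq i r) (ZCol a t m) = 0"
| "A_stack D (Cons i a t m) (XCol j v) = (if j = i \<and> v = Theta a t m then 1 else 0)"
| "A_stack D (Cons i a t m) (ZCol b s k) = (if b = a \<and> s = t \<and> k = m then - 1 else 0)"
| "A_stack D (Ref t m) (XCol j v) = 0"
| "A_stack D (Ref t m) (ZCol b s k) = (if b = ref_area D \<and> s = t \<and> k = m then 1 else 0)"
| "A_stack D (LocIn i r) (XCol j v) = (if j = i then A_in D i r v else 0)"
| "A_stack D (LocIn i r) (ZCol a t m) = 0"

fun Q_stack :: "id_data \<Rightarrow> (nat \<Rightarrow> xvar \<Rightarrow> real) \<Rightarrow> scol \<Rightarrow> scol \<Rightarrow> real" where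
  "Q_stack D x (XCol i u) (XCol j v) = (if i = j then Q_loc D i (x i) u v else 0)"
| "Q_stack D x (XCol i u) (ZCol a t m) = 0"
| "Q_stack D x (ZCol a t m) c = 0"


section \<open>Centralized physical formulation\<close>

datatype cvar = CLoc nat xvar | CTheta nat nat nat | CFlow line nat nat

text \<open>The physical variable by which a coordinate of \<open>(x\<^sub>i)\<^sub>i, (z\<^sub>a)\<^sub>a\<close> is replaced.\<close>

fun physical :: "scol \<Rightarrow> cvar" where
  "physical (XCol i (Theta a t m)) = CTheta a t m"
| "physical (XCol i (Flow e t m)) = CFlow e t m"
| "physical (XCol i v) = CLoc i v"
| "physical (ZCol a t m) = CTheta a t m"

definition central_cols :: "id_data \<Rightarrow> cvar set" where
  "central_cols D = physical ` stack_cols D"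

text \<open>
  Under the substitution the consistency rows become \<open>0 = 0\<close>, and the flow equation and the
  flow bounds of the two end points of a line coincide; the copies of \<open>from(e)\<close> are kept.
\<close>

fun redundant_row :: "srow \<Rightarrow> bool" where
  "redundant_row (Cons i a t m) \<longleftrightarrow> True"
| "redundant_row (LocEq i (FlowDef e t m)) \<longleftrightarrow> i \<noteq> fst e"
| "redundant_row (LocIn i (FlowB b e t m)) \<longleftrightarrow> i \<noteq> fst e"
| "redundant_row _ \<longleftrightarrow> False"

definition central_rows :: "id_data \<Rightarrow> srow set" where
  "central_rows D = {r \<in> stack_rows D. \<not> redundant_row r}"

text \<open>Substituting equal variables adds up their columns.\<close>

definition A_central :: "id_data \<Rightarrow> srow \<Rightarrow> cvar \<Rightarrow> real" where
  "A_central D r c = (\<Sum>w\<in>{w \<in> stack_cols D. physical w = c}. A_stack D r w)"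

definition local_part :: "nat \<Rightarrow> (cvar \<Rightarrow> real) \<Rightarrow> xvar \<Rightarrow> real" where
  "local_part i y v = y (physical (XCol i v))"

definition central_cost :: "id_data \<Rightarrow> (cvar \<Rightarrow> real) \<Rightarrow> real" where
  "central_cost D y = (\<Sum>i\<in>areas D. local_cost D i (local_part i y))"

definition central_feasible :: "id_data \<Rightarrow> (cvar \<Rightarrow> real) \<Rightarrow> bool" where
  "central_feasible D y \<longleftrightarrow>
     ID_feasible D (\<lambda>i. local_part i y) (\<lambda>a t m. y (CTheta a t m))"

definition Q_central :: "id_data \<Rightarrow> (cvar \<Rightarrow> real) \<Rightarrow> cvar \<Rightarrow> cvar \<Rightarrow> real" where
  "Q_central D y = hessian (central_cost D) y"


section \<open>Instance classes\<close>

definition instances :: "nat \<Rightarrow> id_data set" where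
  "instances K\<^sub>l = {D. id_instance D \<and> num_cuts D = K\<^sub>l}"

definition bounded_instances :: "nat \<Rightarrow> nat \<Rightarrow> nat \<Rightarrow> id_data set" where
  "bounded_instances K\<^sub>l K\<^sub>b g\<^sub>b = {D \<in> instances K\<^sub>l.
     \<forall>i\<in>areas D. card (nbrs D i) \<le> K\<^sub>b \<and> card (units_at D i) \<le> g\<^sub>b}"

end

theory Submission
  imports Defs
begin

text \<open>
  Everything that the matrices of an area contain is indexed by a stage \<open>t\<close>, a scenario \<open>m\<close> and
  one of finitely many kinds. There is a fixed number of kinds for the area itself, for each unit
  placed there, and (for a fixed number of loss cuts) for each incident line. The objects of one
  kind form a function of \<open>(t, m)\<close>, called a family here. The point is
  that not only the variables and the rows but also the nonzero entries \<open>(row, column)\<close> of \<open>A\<^sub>i\<close> are covered by \<open>O(1 + K\<^sub>i + g\<^sub>i)\<close> families.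
  Rows that are not sparse do not disturb this. The power balance has one entry for each unit and
  each line, hence one family for each of them. The energy equation of a day-ahead hour \<open>h\<close> has
  as many entries as \<open>h\<close> has stages, but a stage belongs to one hour only, so its entries form
  the single family with row \<open>GateEnergy (hour_of D t) m\<close> and column \<open>Pconv t m\<close>. In the same way,
  comparing every scenario with the first one gives two families per control, although the column
  of a first-scenario control is long. One count (\<open>card_covered_local_le\<close>) thus bounds \<open>n\<^sub>i\<close>, \<open>r\<^sub>i\<close> and
  \<open>nnz(A\<^sub>i)\<close> by a multiple of \<open>HM(1 + K\<^sub>i + g\<^sub>i)\<close>.

  The cost is a sum of terms each reading a single coordinate, apart from the squares of
  \<open>Pgen g t m - Ppump g t m\<close>. So a row of the Hessian has at most two nonzeros, the diagonal one and
  the one of the partner of the coordinate in its square, and \<open>nnz(Q\<^sub>i) \<le> 2n\<^sub>i\<close>. This is derived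
  from a functional equation (\<open>separable_in\<close>) that is preserved by sums and multiples, so no
  derivative of the cost is ever computed.

  Summing over the areas gives the stacked bounds, since the \<open>g\<^sub>i\<close> add up to \<open>|\<G>|\<close> and
  the consistency and reference rows have at most two nonzeros each. Identifying variables adds up columns: an entry
  of the centralized matrix can be nonzero only if an entry of the stacked matrix over it is, so
  its count is not larger. For the densities the counts are divided by the products of the
  dimensions, which are bounded below by the number of balance rows and of variables \<open>Preg\<close> (or
  \<open>z\<close>, in the stacked case).
\<close>

section \<open>Order estimates and counting nonzeros\<close>

text \<open>
  Along a principal filter nothing tends anywhere: an order estimate is a bound on the whole set
  with one constant, which is how the uniformity over all instances is expressed.
\<close>

lemma bigo_principal_iff:
  fixes f g :: "'a \<Rightarrow> real"
  shows "f \<in> O[principal S](g) \<longleftrightarrow> (\<exists>c>0. \<forall>x\<in>S. \<bar>f x\<bar> \<le> c * \<bar>g x\<bar>)"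
  by (simp add: bigo_def eventually_principal)

lemma bigo_principalI:
  fixes f g :: "'a \<Rightarrow> real"
  assumes "c > 0" "\<And>x. x \<in> S \<Longrightarrow> 0 \<le> f x" "\<And>x. x \<in> S \<Longrightarrow> f x \<le> c * g x"
  shows "f \<in> O[principal S](g)"
proof -
  have "\<bar>f x\<bar> \<le> c * \<bar>g x\<bar>" if "x \<in> S" for x
    using assms(2,3)[OF that] mult_left_mono[OF abs_ge_self[of "g x"], of c] assms(1) by linarith
  then show ?thesis using assms(1) by (auto simp: bigo_principal_iff)
qed

lemma bigtheta_principalI:
  fixes f g :: "'a \<Rightarrow> real"
  assumes "\<And>x. x \<in> S \<Longrightarrow> 0 \<le> g x" "\<And>x. x \<in> S \<Longrightarrow> g x \<le> f x"
    and "\<And>x. x \<in> S \<Longrightarrow> f x \<le> c * g x" and "c > 0"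
  shows "f \<in> \<Theta>[principal S](g)"
proof (rule bigthetaI)
  show "f \<in> O[principal S](g)"
    unfolding bigo_principal_iff using assms by (intro exI[of _ c]) (force simp: abs_of_nonneg)
  have "\<forall>x\<in>S. \<bar>g x\<bar> \<le> 1 * \<bar>f x\<bar>" using assms(1,2) by force
  then have "g \<in> O[principal S](f)"
    unfolding bigo_principal_iff by (intro exI[of _ 1]) simp
  then show "f \<in> \<Omega>[principal S](g)" by (simp add: bigomega_iff_bigo)
qed

lemma bigo_principal_SigmaI:
  fixes f g :: "'a \<Rightarrow> 'b \<Rightarrow> real"
  assumes "c > 0" "\<And>a b. a \<in> A \<Longrightarrow> b \<in> B a \<Longrightarrow> 0 \<le> f a b"
    and "\<And>a b. a \<in> A \<Longrightarrow> b \<in> B a \<Longrightarrow> f a b \<le> c * g a b"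
  shows "(\<lambda>(a, b). f a b) \<in> O[principal (Sigma A B)](\<lambda>(a, b). g a b)"
  by (rule bigo_principalI[OF assms(1)]) (use assms(2,3) in auto)

lemma bigtheta_principal_SigmaI:
  fixes f g :: "'a \<Rightarrow> 'b \<Rightarrow> real"
  assumes "\<And>a b. a \<in> A \<Longrightarrow> b \<in> B a \<Longrightarrow> 0 \<le> g a b"
    and "\<And>a b. a \<in> A \<Longrightarrow> b \<in> B a \<Longrightarrow> g a b \<le> f a b"
    and "\<And>a b. a \<in> A \<Longrightarrow> b \<in> B a \<Longrightarrow> f a b \<le> c * g a b" and "c > 0"
  shows "(\<lambda>(a, b). f a b) \<in> \<Theta>[principal (Sigma A B)](\<lambda>(a, b). g a b)"
  by (rule bigtheta_principalI[OF _ _ _ assms(4)]) (use assms(1-3) in auto)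

lemma finite_nonzeros:
  "finite R \<Longrightarrow> finite C \<Longrightarrow> finite {(r, c). r \<in> R \<and> c \<in> C \<and> A r c \<noteq> 0}"
  by (rule finite_subset[of _ "R \<times> C"]) auto

text \<open>
  Used for Hessians, where \<open>p\<close> maps a coordinate to the only other one that it interacts with.
\<close>

lemma nnz_two_per_row:
  assumes "finite R" and "\<And>r c. A r c \<noteq> 0 \<Longrightarrow> r = c \<or> c = p r"
  shows "nnz R C A \<le> 2 * card R"
proof -
  have "{(r, c). r \<in> R \<and> c \<in> C \<and> A r c \<noteq> 0} \<subseteq> (\<lambda>r. (r, r)) ` R \<union> (\<lambda>r. (r, p r)) ` R"
    using assms(2) by auto
  then have "nnz R C A \<le> card ((\<lambda>r. (r, r)) ` R \<union> (\<lambda>r. (r, p r)) ` R)"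
    unfolding nnz_def by (rule card_mono[rotated]) (simp add: assms(1))
  also have "\<dots> \<le> card ((\<lambda>r. (r, r)) ` R) + card ((\<lambda>r. (r, p r)) ` R)"
    by (rule card_Un_le)
  also have "\<dots> \<le> 2 * card R"
    using card_image_le[OF assms(1), of "\<lambda>r. (r, r)"] card_image_le[OF assms(1), of "\<lambda>r. (r, p r)"]
    by simp
  finally show ?thesis .
qed

section \<open>Hessians\<close>

text \<open>
  The mixed second difference of \<open>f\<close> in the coordinates \<open>u\<close> and \<open>v\<close> vanishes. For \<open>u \<noteq> v\<close> this says
  that \<open>f\<close> is the sum of a function without \<open>u\<close> and a function without \<open>v\<close>. In contrast to a vanishing mixed
  derivative, this can be checked term by term without any differentiability.
\<close>

definition separable_in :: "(('v \<Rightarrow> real) \<Rightarrow> real) \<Rightarrow> 'v \<Rightarrow> 'v \<Rightarrow> bool" where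
  "separable_in f u v \<longleftrightarrow> (\<forall>x s r. f (x(u := s, v := r)) + f x = f (x(u := s)) + f (x(v := r)))"

text \<open>
  The two functions have the same derivatives at \<open>a\<close>, if any, so \<open>deriv\<close> chooses the same value
  even where \<open>g\<close> is not differentiable.
\<close>

lemma deriv_add_const: "deriv (\<lambda>r. g r + c) a = deriv g (a :: real)" for c :: real
proof -
  have "DERIV (\<lambda>r. g r + c) a :> d \<longleftrightarrow> DERIV g a :> d" for d
  proof
    assume "DERIV (\<lambda>r. g r + c) a :> d"
    from DERIV_diff[OF this DERIV_const[of c]] show "DERIV g a :> d" by simp
  next
    assume "DERIV g a :> d"
    from DERIV_add[OF this DERIV_const[of c]] show "DERIV (\<lambda>r. g r + c) a :> d" by simp
  qed
  then show ?thesis by (simp add: deriv_def)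
qed

text \<open>
  Changing the coordinate \<open>u\<close> changes \<open>f\<close>, as a function of the coordinate \<open>v\<close>, by a constant only.
  Hence the partial derivative in \<open>v\<close> does not depend on \<open>u\<close>.
\<close>

lemma hessian_zero_if_separable:
  assumes "u \<noteq> v" and "separable_in f u v"
  shows "hessian f x u v = 0"
proof -
  have "partial f v (x(u := s)) = deriv (\<lambda>r. f (x(v := r))) (x v)" for s
  proof -
    have "f (x(u := s, v := r)) = f (x(v := r)) + (f (x(u := s)) - f x)" for r
      using assms(2) unfolding separable_in_def by (smt (verit))
    then show ?thesis using assms(1) by (simp add: partial_def deriv_add_const)
  qed
  then show ?thesis by (simp add: hessian_def partial_def[of "partial f v"])
qed

lemma separable_in_const: "separable_in (\<lambda>x. c) u v"
  by (simp add: separable_in_def)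

lemma separable_in_coord: "u \<noteq> v \<Longrightarrow> separable_in (\<lambda>x. x w) u v"
  by (simp add: separable_in_def)

lemma separable_in_add:
  "separable_in f u v \<Longrightarrow> separable_in g u v \<Longrightarrow> separable_in (\<lambda>x. f x + g x) u v"
  unfolding separable_in_def by (smt (verit))

lemma separable_in_diff:
  "separable_in f u v \<Longrightarrow> separable_in g u v \<Longrightarrow> separable_in (\<lambda>x. f x - g x) u v"
  unfolding separable_in_def by (smt (verit))

lemma separable_in_scale:
  "separable_in f u v \<Longrightarrow> separable_in (\<lambda>x. c * f x) u v"
  unfolding separable_in_def by (simp flip: distrib_left)

lemma separable_in_scale_right:
  "separable_in f u v \<Longrightarrow> separable_in (\<lambda>x. f x * c) u v"
  unfolding separable_in_def by (simp flip: distrib_right)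

lemma separable_in_if:
  "separable_in f u v \<Longrightarrow> separable_in g u v \<Longrightarrow> separable_in (\<lambda>x. if b then f x else g x) u v"
  by (cases b) simp_all

lemma separable_in_sum:
  "(\<And>a. a \<in> I \<Longrightarrow> separable_in (f a) u v) \<Longrightarrow> separable_in (\<lambda>x. \<Sum>a\<in>I. f a x) u v"
  unfolding separable_in_def by (simp flip: sum.distrib)

lemma separable_in_square_coord:
  "u \<noteq> v \<Longrightarrow> separable_in (\<lambda>x. (x w)\<^sup>2) u v"
  "u \<noteq> v \<Longrightarrow> separable_in (\<lambda>x. (x w - c)\<^sup>2) u v"
  by (auto simp: separable_in_def)

lemma separable_in_square_diff:
  "u \<noteq> v \<Longrightarrow> {u, v} \<noteq> {a, b} \<Longrightarrow> separable_in (\<lambda>x. (x a - x b)\<^sup>2) u v"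
  by (auto simp: separable_in_def)

lemmas separable_in_intros = separable_in_const separable_in_coord separable_in_add
  separable_in_diff separable_in_scale separable_in_scale_right separable_in_if separable_in_sum
  separable_in_square_coord separable_in_square_diff

text \<open>
  The other coordinate in the square of \<open>Pgen g t m - Ppump g t m\<close>. Being its own partner means that
  a coordinate interacts with no other one.
\<close>

fun partner :: "xvar \<Rightarrow> xvar" where
  "partner (Pgen g t m) = Ppump g t m"
| "partner (Ppump g t m) = Pgen g t m"
| "partner v = v"

text \<open>
  The only terms that read two coordinates jointly are the squares of the generation costs, and by
  the assumption on \<open>partner\<close> none of them reads exactly \<open>u\<close> and \<open>v\<close>.
\<close>

lemma separable_local_cost:
  assumes "u \<noteq> v" and "v \<noteq> partner u"
  shows "separable_in (local_cost D i) u v"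
proof -
  have "{u, v} \<noteq> {Pgen g t m, Ppump g t m}" for g t m
    using assms by (auto simp: doubleton_eq_iff)
  then show ?thesis
    unfolding local_cost_def[abs_def] stage_cost_def
    by (intro separable_in_intros assms(1))
qed

lemma Q_loc_nonzero: "Q_loc D i x u v \<noteq> 0 \<Longrightarrow> u = v \<or> v = partner u"
  using hessian_zero_if_separable[OF _ separable_local_cost] unfolding Q_loc_def by blast

lemma physical_XCol_eq_iff: "physical (XCol i u) = physical (XCol i v) \<longleftrightarrow> u = v"
  by (cases u; cases v) simp_all

lemma local_part_upd:
  "local_part i (y(physical (XCol i v) := s)) = (local_part i y)(v := s)"
  by (auto simp: local_part_def fun_eq_iff physical_XCol_eq_iff)

lemma local_part_upd_other:
  "c \<notin> range (\<lambda>v. physical (XCol i v)) \<Longrightarrow> local_part i (y(c := s)) = local_part i y"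
  by (auto simp: local_part_def fun_eq_iff)

fun central_partner :: "cvar \<Rightarrow> cvar" where
  "central_partner (CLoc i v) = CLoc i (partner v)"
| "central_partner c = c"

lemma central_partner_physical:
  "central_partner (physical (XCol i v)) = physical (XCol i (partner v))"
  by (cases v) simp_all

text \<open>
  For a fixed area the substitution of physical variables is injective, so a summand of the cost
  sees at most one of its own coordinates behind each physical variable. If one of the two
  variables is not seen by the area at all, separability is trivial; a shared angle or flow
  therefore creates no new coupling.
\<close>

lemma separable_central_cost:
  assumes "u \<noteq> v" and "v \<noteq> central_partner u"
  shows "separable_in (central_cost D) u v"
proof -
  have "separable_in (\<lambda>y. local_cost D i (local_part i y)) u v" for i
  proof -
    let ?own = "range (\<lambda>w. physical (XCol i w))"
    consider "u \<in> ?own" "v \<in> ?own" | "u \<notin> ?own" | "v \<notin> ?own" by blast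
    then show ?thesis
    proof cases
      case 1
      then obtain u' v' where uv: "u = physical (XCol i u')" "v = physical (XCol i v')" by blast
      have "u' \<noteq> v'" "v' \<noteq> partner u'" using assms uv by (auto simp: central_partner_physical)
      from separable_local_cost[OF this, of D i] show ?thesis
        by (simp add: separable_in_def local_part_upd uv)
    next
      case 2
      then show ?thesis
        by (simp add: separable_in_def local_part_upd_other fun_upd_twist[OF assms(1)])
    next
      case 3
      then show ?thesis by (simp add: separable_in_def local_part_upd_other)
    qed
  qed
  then show ?thesis unfolding central_cost_def[abs_def] by (intro separable_in_sum)
qed

lemma Q_central_nonzero: "Q_central D y u v \<noteq> 0 \<Longrightarrow> u = v \<or> v = central_partner u"
  using hessian_zero_if_separable[OF _ separable_central_cost] unfolding Q_central_def by blast

section \<open>Local rows, columns and entries\<close>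

lemma id_instance_network:
  assumes "id_instance D"
  shows "\<forall>i j. (i, j) \<in> lines D \<longrightarrow> i \<noteq> j \<and> (j, i) \<notin> lines D" and "ref_area D \<in> areas D"
  using assms unfolding id_instance_def by - (elim conjE, assumption)+

lemma finite_units_at: "id_instance D \<Longrightarrow> finite (units_at D i)"
  using id_instance_finite(2) by (simp add: units_at_def)

lemma finite_inc_lines: "id_instance D \<Longrightarrow> finite (inc_lines D i)"
  using id_instance_finite(1) by (simp add: inc_lines_def)

lemma finite_nbrs: "id_instance D \<Longrightarrow> finite (nbrs D i)"
proof (rule finite_subset)
  show "nbrs D i \<subseteq> fst ` lines D \<union> snd ` lines D" by (force simp: nbrs_def)
qed (simp add: id_instance_finite)

lemma nbrs_eq_other_end: "nbrs D i = other_end i ` inc_lines D i"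
  by (force simp: nbrs_def inc_lines_def other_end_def image_def)

text \<open>
  Sending an incident line to its other end is injective, as two areas are joined by at most one
  line, in one of the two orientations.
\<close>

lemma card_inc_lines:
  assumes D: "id_instance D"
  shows "card (inc_lines D i) = card (nbrs D i)"
proof -
  have "(k, j) \<notin> lines D" if "(j, k) \<in> lines D" for j k
    using id_instance_network(1)[OF D] that by blast
  then have "inj_on (other_end i) (inc_lines D i)"
    by (auto simp: inj_on_def inc_lines_def other_end_def split: if_splits)
  then show ?thesis unfolding nbrs_eq_other_end by (rule card_image[symmetric])
qed

text \<open>
  Stages run up to \<open>horizon D\<close> inclusively, to have room for the battery states \<open>E\<^sub>i(H,m)\<close>. Families
  indexed by scenarios only are regarded as constant in the stage.
\<close>

definition covered :: "id_data \<Rightarrow> (nat \<Rightarrow> nat \<Rightarrow> 's) set \<Rightarrow> 's \<Rightarrow> bool" where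
  "covered D F s \<longleftrightarrow> (\<exists>f\<in>F. \<exists>t\<le>horizon D. \<exists>m\<in>scens D. s = f t m)"

lemma covered_list_all:
  "t \<le> horizon D \<Longrightarrow> m \<in> scens D \<Longrightarrow> set fs \<subseteq> F \<Longrightarrow> list_all (\<lambda>f. covered D F (f t m)) fs"
  unfolding list_all_iff covered_def by blast

lemma finite_covered:
  assumes "finite F"
  shows "finite {s. covered D F s}"
proof -
  have "{s. covered D F s} = (\<Union>f\<in>F. \<Union>t\<le>horizon D. \<Union>m\<in>scens D. {f t m})"
    unfolding covered_def by blast
  then show ?thesis using assms by simp
qed

lemma card_covered_le:
  assumes D: "id_instance D" and F: "finite F" "card F \<le> k"
    and S: "\<And>s. s \<in> S \<Longrightarrow> covered D F s"
  shows "card S \<le> 2 * k * (horizon D * num_scen D)"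
proof -
  let ?TM = "{..horizon D} \<times> scens D"
  have "S \<subseteq> (\<lambda>(f, t, m). f t m) ` (F \<times> ?TM)"
  proof
    fix s assume "s \<in> S"
    then obtain f t m where "f \<in> F" "t \<le> horizon D" "m \<in> scens D" "s = f t m"
      using S unfolding covered_def by blast
    then show "s \<in> (\<lambda>(f, t, m). f t m) ` (F \<times> ?TM)"
      by (intro image_eqI[of _ _ "(f, t, m)"]) auto
  qed
  then have "card S \<le> card (F \<times> ?TM)"
    by (rule surj_card_le[rotated]) (simp add: F)
  also have "\<dots> = card F * ((horizon D + 1) * num_scen D)"
    by (simp add: card_cartesian_product)
  \<comment> \<open>\<open>H + 1 \<le> 2H\<close> because \<open>H \<ge> 1\<close>\<close>
  also have "\<dots> \<le> k * ((2 * horizon D) * num_scen D)"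
    using F(2) id_instance_finite(3)[OF D] by (intro mult_le_mono) simp_all
  finally show ?thesis by (simp add: algebra_simps)
qed

text \<open>
  Families are grouped by the asset that they belong to: the area \<open>i\<close> itself, a unit \<open>g\<close> or an
  incident line \<open>e\<close>. They are given by lists because the length of an explicit list bounds the
  number of its elements without a proof that these functions are distinct.
\<close>

definition local_families ::
    "id_data \<Rightarrow> nat \<Rightarrow> 'f list \<Rightarrow> (nat \<Rightarrow> 'f list) \<Rightarrow> (line \<Rightarrow> 'f list) \<Rightarrow> 'f set" where
  "local_families D i as us ls =
     set as \<union> (\<Union>g\<in>units_at D i. set (us g)) \<union> (\<Union>e\<in>inc_lines D i. set (ls e))"

definition local_size :: "id_data \<Rightarrow> nat \<Rightarrow> nat" where
  "local_size D i = horizon D * num_scen D * (1 + card (nbrs D i) + card (units_at D i))"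

lemma card_covered_local_le:
  assumes D: "id_instance D"
    and len: "length as \<le> k" "\<And>g. length (us g) \<le> k" "\<And>e. length (ls e) \<le> k"
    and S: "\<And>s. s \<in> S \<Longrightarrow> covered D (local_families D i as us ls) s"
  shows "card S \<le> 2 * k * local_size D i"
proof -
  let ?F = "local_families D i as us ls"
  have bound: "card (\<Union>a\<in>I. set (xs a)) \<le> k * card I"
    if "finite I" "\<And>a. length (xs a) \<le> k" for I :: "'i set" and xs :: "'i \<Rightarrow> 'f list"
  proof -
    have "card (\<Union>a\<in>I. set (xs a)) \<le> (\<Sum>a\<in>I. card (set (xs a)))"
      by (rule card_UN_le[OF that(1)])
    also have "\<dots> \<le> (\<Sum>a\<in>I. k)"
      using that(2) by (intro sum_mono) (meson card_length le_trans)
    finally show ?thesis by (simp add: mult.commute)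
  qed
  have "card ?F \<le> card (set as) + card (\<Union>g\<in>units_at D i. set (us g))
      + card (\<Union>e\<in>inc_lines D i. set (ls e))"
    unfolding local_families_def by (meson add_le_mono1 card_Un_le le_trans)
  also have "\<dots> \<le> k + k * card (units_at D i) + k * card (inc_lines D i)"
    using len by (intro add_mono bound finite_units_at[OF D] finite_inc_lines[OF D])
      (meson card_length le_trans)
  also have "\<dots> = k * (1 + card (nbrs D i) + card (units_at D i))"
    using card_inc_lines[OF D] by (simp add: algebra_simps)
  finally have "card ?F \<le> k * (1 + card (nbrs D i) + card (units_at D i))" .
  from card_covered_le[OF D _ this S] show ?thesis
    by (simp add: local_families_def local_size_def finite_units_at[OF D] finite_inc_lines[OF D] algebra_simps)
qed

text \<open>
  The families describe a supply of possible variables. Assets that the area does not have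
  are listed as well, which is harmless for upper bounds.
\<close>

definition area_vars :: "nat \<Rightarrow> (nat \<Rightarrow> nat \<Rightarrow> xvar) list" where
  "area_vars i = [Pconv, Qpos, Qneg, \<lambda>t m. Spk m, Pch, Pdis, Soc, Pres, Preg, Theta i]"

definition unit_vars :: "nat \<Rightarrow> (nat \<Rightarrow> nat \<Rightarrow> xvar) list" where
  "unit_vars g = [Pgen g, Ppump g]"

definition line_vars :: "nat \<Rightarrow> line \<Rightarrow> (nat \<Rightarrow> nat \<Rightarrow> xvar) list" where
  "line_vars i e = [Theta (other_end i e), Flow e, Loss e]"

definition var_families :: "id_data \<Rightarrow> nat \<Rightarrow> (nat \<Rightarrow> nat \<Rightarrow> xvar) set" where
  "var_families D i = local_families D i (area_vars i) unit_vars (line_vars i)"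

lemma var_list_subset:
  "set (area_vars i) \<subseteq> var_families D i"
  "g \<in> units_at D i \<Longrightarrow> set (unit_vars g) \<subseteq> var_families D i"
  "e \<in> inc_lines D i \<Longrightarrow> set (line_vars i e) \<subseteq> var_families D i"
  unfolding var_families_def local_families_def by blast+

lemmas covered_area_vars =
  covered_list_all[OF _ _ var_list_subset(1)[of i D], of t D m, unfolded area_vars_def, simplified]
  for D i t m
lemmas covered_unit_vars =
  covered_list_all[OF _ _ var_list_subset(2)[of g D i], of t D m, unfolded unit_vars_def, simplified]
  for D i g t m
lemmas covered_line_vars =
  covered_list_all[OF _ _ var_list_subset(3)[of e D i], of t D m, unfolded line_vars_def list.pred_inject]
  for D i e t m

lemma covered_var:
  assumes v: "v \<in> xvars D i"
  shows "covered D (var_families D i) v"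
proof (cases v)
  case (Theta a t m)
  then show ?thesis
    using v covered_area_vars[where t = t and m = m and D = D and i = i] covered_line_vars[where t = t and m = m and D = D and i = i]
    by (auto simp: xvars_def nbrs_eq_other_end)
next
  case (Spk m)
  then show ?thesis using v covered_area_vars[where t = 0 and m = m and D = D and i = i]
    by (simp add: xvars_def)
qed (use v covered_area_vars[where D = D and i = i] covered_unit_vars[where D = D and i = i] covered_line_vars[where D = D and i = i]
  in \<open>simp_all add: xvars_def inc_lines_def\<close>)

lemma card_xvars_le:
  assumes D: "id_instance D"
  shows "card (xvars D i) \<le> 20 * local_size D i"
  using card_covered_local_le[OF D _ _ _ covered_var[unfolded var_families_def, of _ D i], where k = 10]
  by (simp add: area_vars_def unit_vars_def line_vars_def)

text \<open>
  The positions in \<open>A\<^sub>i\<close> at which an entry may be nonzero, again grouped by area, unit and line.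
  Families may overlap: the two of \<open>RampB\<close> coincide at stage \<open>0\<close>, where \<open>t - 1 = t\<close> and where the
  row indeed reads \<open>Pconv 0 m\<close> only.
\<close>

type_synonym entry_family = "nat \<Rightarrow> nat \<Rightarrow> (eq_row + in_row) \<times> xvar"

definition area_entries :: "id_data \<Rightarrow> entry_family list" where
  "area_entries D =
    [\<lambda>t m. (Inl (Balance t m), Pconv t m),
     \<lambda>t m. (Inl (Balance t m), Pdis t m),
     \<lambda>t m. (Inl (Balance t m), Pch t m),
     \<lambda>t m. (Inl (Balance t m), Pres t m),
     \<lambda>t m. (Inl (Balance t m), Preg t m),
     \<lambda>t m. (Inl (SocInit m), Soc 0 m),
     \<lambda>t m. (Inl (SocDyn t m), Soc (t + 1) m),
     \<lambda>t m. (Inl (SocDyn t m), Soc t m),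
     \<lambda>t m. (Inl (SocDyn t m), Pch t m),
     \<lambda>t m. (Inl (SocDyn t m), Pdis t m),
     \<lambda>t m. (Inl (ConvSplit t m), Pconv t m),
     \<lambda>t m. (Inl (ConvSplit t m), Qpos t m),
     \<lambda>t m. (Inl (ConvSplit t m), Qneg t m),
     \<lambda>t m. (Inl (GateEnergy (hour_of D t) m), Pconv t m),
     \<lambda>t m. (Inr (SocTerm m), Soc (horizon D) m),
     \<lambda>t m. (Inr (QposNN t m), Qpos t m),
     \<lambda>t m. (Inr (QnegNN t m), Qneg t m),
     \<lambda>t m. (Inr (PeakCut t m), Qpos t m),
     \<lambda>t m. (Inr (PeakCut t m), Spk m),
     \<lambda>t m. (Inr (PeakNN m), Spk m)]
    @ concat (map (\<lambda>b.
        [\<lambda>t m. (Inr (RegB b t m), Preg t m),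
         \<lambda>t m. (Inr (SocB b t m), Soc t m),
         \<lambda>t m. (Inr (ChB b t m), Pch t m),
         \<lambda>t m. (Inr (DisB b t m), Pdis t m),
         \<lambda>t m. (Inr (ConvB b t m), Pconv t m),
         \<lambda>t m. (Inr (RampB b t m), Pconv t m),
         \<lambda>t m. (Inr (RampB b t m), Pconv (t - 1) m),
         \<lambda>t m. (Inr (ResB b t m), Pres t m)]) [Lo, Up])
    @ concat (map (\<lambda>c.
        [\<lambda>t m. (Inl (NonAnt c m), ctrl_var c 0 m),
         \<lambda>t m. (Inl (NonAnt c m), ctrl_var c 0 1)]) [U_conv, U_ch, U_dis, U_res, U_reg])"

definition unit_entries :: "nat \<Rightarrow> entry_family list" where
  "unit_entries g =
    [\<lambda>t m. (Inl (Balance t m), Pgen g t m),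
     \<lambda>t m. (Inl (Balance t m), Ppump g t m)]
    @ concat (map (\<lambda>b.
        [\<lambda>t m. (Inr (GenB b g t m), Pgen g t m),
         \<lambda>t m. (Inr (PumpB b g t m), Ppump g t m)]) [Lo, Up])
    @ concat (map (\<lambda>c.
        [\<lambda>t m. (Inl (NonAnt c m), ctrl_var c 0 m),
         \<lambda>t m. (Inl (NonAnt c m), ctrl_var c 0 1)]) [U_gen g, U_pump g])"

definition line_entries :: "id_data \<Rightarrow> nat \<Rightarrow> line \<Rightarrow> entry_family list" where
  "line_entries D i e =
    [\<lambda>t m. (Inl (Balance t m), Flow e t m),
     \<lambda>t m. (Inl (FlowDef e t m), Flow e t m),
     \<lambda>t m. (Inl (FlowDef e t m), Theta i t m),
     \<lambda>t m. (Inl (FlowDef e t m), Theta (other_end i e) t m),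
     \<lambda>t m. (Inr (FlowB Lo e t m), Flow e t m),
     \<lambda>t m. (Inr (FlowB Up e t m), Flow e t m)]
    @ concat (map (\<lambda>k.
        [\<lambda>t m. (Inr (LossCut e k t m), Flow e t m),
         \<lambda>t m. (Inr (LossCut e k t m), Loss e t m)]) [1..<num_cuts D + 1])"

definition entry_families :: "id_data \<Rightarrow> nat \<Rightarrow> entry_family set" where
  "entry_families D i = local_families D i (area_entries D) unit_entries (line_entries D i)"

text \<open>
  The area contributes \<open>20 + 2 * 8 + 5 * 2 = 46\<close> families, a unit \<open>10\<close>, and a line \<open>6 + 2 K\<^sub>\<ell>\<close>.
\<close>

lemma length_entries:
  "length (area_entries D) \<le> 46 + 2 * num_cuts D"
  "length (unit_entries g) \<le> 46 + 2 * num_cuts D"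
  "length (line_entries D i e) \<le> 46 + 2 * num_cuts D"
proof -
  have "length (concat (map (\<lambda>k. [f k, h k]) ks)) = 2 * length ks"
    for ks :: "nat list" and f h :: "nat \<Rightarrow> entry_family"
    by (induction ks) simp_all
  then show "length (line_entries D i e) \<le> 46 + 2 * num_cuts D"
    by (simp add: line_entries_def)
qed (simp_all add: area_entries_def unit_entries_def)

text \<open>
  The balance is the one row whose length depends on the number of units and lines.
\<close>

lemma coef_injection_nonzero:
  assumes "coef (injection D i t m) v \<noteq> 0"
  shows "v \<in> {Pconv t m, Pdis t m, Pch t m, Pres t m, Preg t m}
      \<union> (\<Union>g\<in>units_at D i. {Pgen g t m, Ppump g t m}) \<union> (\<Union>e\<in>inc_lines D i. {Flow e t m})"
proof (rule ccontr)
  assume N: "\<not> ?thesis"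
  then have "(\<Sum>g\<in>units_at D i. of_bool (Pgen g t m = v) - of_bool (Ppump g t m = v) :: real) = 0"
    by (intro sum.neutral) auto
  moreover have "(\<Sum>e\<in>inc_lines D i. orient i e * of_bool (Flow e t m = v)) = 0"
    using N by (intro sum.neutral) auto
  moreover have "Pconv t m \<noteq> v" "Pdis t m \<noteq> v" "Pch t m \<noteq> v" "Pres t m \<noteq> v" "Preg t m \<noteq> v"
    using N by auto
  ultimately show False
    using assms by (simp add: coef_def injection_def cong: if_cong)
qed

lemma entry_list_subset:
  "set (area_entries D) \<subseteq> entry_families D i"
  "g \<in> units_at D i \<Longrightarrow> set (unit_entries g) \<subseteq> entry_families D i"
  "e \<in> inc_lines D i \<Longrightarrow> set (line_entries D i e) \<subseteq> entry_families D i"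
  unfolding entry_families_def local_families_def by blast+

lemmas covered_area_entries =
  covered_list_all[OF _ _ entry_list_subset(1)[of D i], of t D m, unfolded area_entries_def, simplified]
  for D i t m
lemmas covered_unit_entries =
  covered_list_all[OF _ _ entry_list_subset(2)[of g D i], of t D m, unfolded unit_entries_def, simplified]
  for D i g t m

text \<open>
  For lines the list is not explicit, since the number of loss cuts is a parameter.
\<close>

lemma covered_line_entries:
  assumes "t \<le> horizon D" "m \<in> scens D" "e \<in> inc_lines D i"
  shows "covered D (entry_families D i) (Inl (Balance t m), Flow e t m)"
    "covered D (entry_families D i) (Inl (FlowDef e t m), Flow e t m)"
    "covered D (entry_families D i) (Inl (FlowDef e t m), Theta i t m)"
    "covered D (entry_families D i) (Inl (FlowDef e t m), Theta (other_end i e) t m)"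
    "covered D (entry_families D i) (Inr (FlowB b e t m), Flow e t m)"
    "k \<in> {1..num_cuts D} \<Longrightarrow> covered D (entry_families D i) (Inr (LossCut e k t m), Flow e t m)"
    "k \<in> {1..num_cuts D} \<Longrightarrow> covered D (entry_families D i) (Inr (LossCut e k t m), Loss e t m)"
proof -
  note C = covered_list_all[OF assms(1,2) entry_list_subset(3)[OF assms(3)],
      unfolded line_entries_def list_all_append]
  from C[THEN conjunct1]
  show "covered D (entry_families D i) (Inl (Balance t m), Flow e t m)"
    "covered D (entry_families D i) (Inl (FlowDef e t m), Flow e t m)"
    "covered D (entry_families D i) (Inl (FlowDef e t m), Theta i t m)"
    "covered D (entry_families D i) (Inl (FlowDef e t m), Theta (other_end i e) t m)"
    "covered D (entry_families D i) (Inr (FlowB b e t m), Flow e t m)"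
    by (cases b; simp)+
  from C[THEN conjunct2]
  show "covered D (entry_families D i) (Inr (LossCut e k t m), Flow e t m)"
    "covered D (entry_families D i) (Inr (LossCut e k t m), Loss e t m)" if "k \<in> {1..num_cuts D}"
    using that by (simp_all add: list_all_iff del: upt_Suc)
qed

text \<open>
  A row form is evaluated at a unit vector, and it can be nonzero only if the row reads that
  coordinate. In the rows that do not depend on a stage (initial and terminal battery state, peak
  sign, non-anticipativity) the stage \<open>0\<close> is taken as the index of the family.
\<close>

lemma A_loc_nonzero_covered:
  assumes r: "r \<in> loc_rows D i" and nz: "A_loc D i r v \<noteq> 0"
  shows "covered D (entry_families D i) (r, v)"
proof (cases r)
  case (Inl q)
  note A = covered_area_entries[where D = D and i = i]
    and U = covered_unit_entries[where D = D and i = i]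
    and L = covered_line_entries[where D = D and i = i]
  note defs = loc_rows_def eq_rows_def A_loc_def A_eq_def coef_def
  show ?thesis
  proof (cases q)
    case (Balance t m)
    then have "t \<le> horizon D" "m \<in> scens D"
      "v \<in> {Pconv t m, Pdis t m, Pch t m, Pres t m, Preg t m}
        \<union> (\<Union>g\<in>units_at D i. {Pgen g t m, Ppump g t m}) \<union> (\<Union>e\<in>inc_lines D i. {Flow e t m})"
      using r nz Inl coef_injection_nonzero[of D i t m v]
      by (auto simp: loc_rows_def eq_rows_def A_loc_def A_eq_def eq_lhs.simps[abs_def])
    then show ?thesis using Balance Inl A[where t = t and m = m] U[where t = t and m = m] L[where t = t and m = m]
      by auto
  next
    case (FlowDef e t m)
    then show ?thesis using r nz Inl L[where t = t and m = m and e = e]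
      by (auto simp: defs of_bool_def split: if_splits)
  next
    case (SocInit m)
    then show ?thesis using r nz Inl A[where t = 0 and m = m]
      by (auto simp: defs of_bool_def split: if_splits)
  next
    case (SocDyn t m)
    then show ?thesis using r nz Inl A[where t = t and m = m]
      by (auto simp: defs of_bool_def split: if_splits)
  next
    case (ConvSplit t m)
    then show ?thesis using r nz Inl A[where t = t and m = m]
      by (auto simp: defs of_bool_def split: if_splits)
  next
    \<comment> \<open>The stage of the column determines the hour of the row.\<close>
    case (GateEnergy h m)
    then have "(\<Sum>t\<in>stages_in_hour D h. of_bool (Pconv t m = v)) \<noteq> (0::real)"
      using nz Inl by (auto simp: defs)
    then obtain t where "t \<in> stages_in_hour D h" "of_bool (Pconv t m = v) \<noteq> (0::real)"
      by (rule sum.not_neutral_contains_not_neutral)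
    then have "t \<in> stages_in_hour D h" "v = Pconv t m" by simp_all
    then show ?thesis using r GateEnergy Inl A[where t = t and m = m]
      by (auto simp: defs stages_in_hour_def)
  next
    case (NonAnt c m)
    then have "v = ctrl_var c 0 m \<or> v = ctrl_var c 0 1" "is_ctrl D i c" "m \<in> scens D"
      using r nz Inl by (auto simp: defs of_bool_def split: if_splits)
    then show ?thesis using NonAnt Inl A[where t = 0 and m = m] U[where t = 0 and m = m]
      by (cases c) auto
  qed
next
  case (Inr q)
  note A = covered_area_entries[where D = D and i = i]
    and U = covered_unit_entries[where D = D and i = i]
    and L = covered_line_entries[where D = D and i = i]
  note defs = loc_rows_def in_rows_def A_loc_def A_in_def coef_def
  show ?thesis
  proof (cases q)
    case (RegB b t m)
    then show ?thesis using r nz Inr A[where t = t and m = m]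
      by (cases b) (auto simp: defs of_bool_def split: if_splits)
  next
    case (FlowB b e t m)
    then show ?thesis using r nz Inr L[where t = t and m = m and e = e]
      by (cases b) (auto simp: defs of_bool_def split: if_splits)
  next
    case (LossCut e k t m)
    then show ?thesis using r nz Inr L[where t = t and m = m and e = e]
      by (auto simp: defs inc_lines_def of_bool_def split: if_splits)
  next
    case (SocB b t m)
    then show ?thesis using r nz Inr A[where t = t and m = m]
      by (cases b) (auto simp: defs of_bool_def split: if_splits)
  next
    case (ChB b t m)
    then show ?thesis using r nz Inr A[where t = t and m = m]
      by (cases b) (auto simp: defs of_bool_def split: if_splits)
  next
    case (DisB b t m)
    then show ?thesis using r nz Inr A[where t = t and m = m]
      by (cases b) (auto simp: defs of_bool_def split: if_splits)
  next
    case (SocTerm m)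
    then show ?thesis using r nz Inr A[where t = 0 and m = m]
      by (auto simp: defs of_bool_def split: if_splits)
  next
    case (QposNN t m)
    then show ?thesis using r nz Inr A[where t = t and m = m]
      by (auto simp: defs of_bool_def split: if_splits)
  next
    case (QnegNN t m)
    then show ?thesis using r nz Inr A[where t = t and m = m]
      by (auto simp: defs of_bool_def split: if_splits)
  next
    case (ConvB b t m)
    then show ?thesis using r nz Inr A[where t = t and m = m]
      by (cases b) (auto simp: defs of_bool_def split: if_splits)
  next
    case (RampB b t m)
    then show ?thesis using r nz Inr A[where t = t and m = m]
      by (cases b) (auto simp: defs of_bool_def split: if_splits)
  next
    case (GenB b g t m)
    then show ?thesis using r nz Inr U[where t = t and m = m and g = g]
      by (cases b) (auto simp: defs of_bool_def split: if_splits)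
  next
    case (PumpB b g t m)
    then show ?thesis using r nz Inr U[where t = t and m = m and g = g]
      by (cases b) (auto simp: defs of_bool_def split: if_splits)
  next
    case (ResB b t m)
    then show ?thesis using r nz Inr A[where t = t and m = m]
      by (cases b) (auto simp: defs of_bool_def split: if_splits)
  next
    case (PeakCut t m)
    then show ?thesis using r nz Inr A[where t = t and m = m]
      by (auto simp: defs of_bool_def split: if_splits)
  next
    case (PeakNN m)
    then show ?thesis using r nz Inr A[where t = 0 and m = m]
      by (auto simp: defs of_bool_def split: if_splits)
  qed
qed

definition entries :: "id_data \<Rightarrow> nat \<Rightarrow> ((eq_row + in_row) \<times> xvar) set" where
  "entries D i = {p. covered D (entry_families D i) p}"

lemma finite_entries:
  assumes D: "id_instance D"
  shows "finite (entries D i)"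
proof -
  have "finite (entry_families D i)"
    using finite_units_at[OF D] finite_inc_lines[OF D]
    by (simp add: entry_families_def local_families_def)
  then show ?thesis unfolding entries_def by (rule finite_covered)
qed

lemma card_entries_le:
  assumes D: "id_instance D"
  shows "card (entries D i) \<le> (92 + 4 * num_cuts D) * local_size D i"
proof -
  have "card (entries D i) \<le> 2 * (46 + 2 * num_cuts D) * local_size D i"
    by (rule card_covered_local_le[OF D length_entries]) (simp add: entries_def entry_families_def)
  then show ?thesis by simp
qed

text \<open>
  Every kind of row occurs in some entry family, so the count of the entries also bounds the
  number of rows. For the energy rows this uses that an hour in \<open>gate_hours\<close> meets the horizon:
  otherwise their number would not be bounded in terms of \<open>H\<close>.
\<close>

lemma loc_rows_subset_entries: "loc_rows D i \<subseteq> fst ` entries D i"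
proof
  fix r assume r: "r \<in> loc_rows D i"
  note A = covered_area_entries[where D = D and i = i]
    and U = covered_unit_entries[where D = D and i = i]
    and L = covered_line_entries[where D = D and i = i]
  have "\<exists>v. covered D (entry_families D i) (r, v)"
  proof (cases r)
    case (Inl q)
    show ?thesis
    proof (cases q)
      case (GateEnergy h m)
      then obtain t where "t \<in> stages_in_hour D h" "m \<in> scens D"
        using r Inl by (auto simp: loc_rows_def eq_rows_def gate_hours_def)
      then show ?thesis
        using GateEnergy Inl A[where t = t and m = m] by (auto simp: stages_in_hour_def)
    next
      case (SocInit m)
      then show ?thesis using r Inl A[where t = 0 and m = m]
        by (auto simp: loc_rows_def eq_rows_def)
    next
      case (NonAnt c m)
      then have "covered D (entry_families D i) (r, ctrl_var c 0 m)"
        using r Inl A[where t = 0 and m = m] U[where t = 0 and m = m]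
        by (cases c) (auto simp: loc_rows_def eq_rows_def)
      then show ?thesis by blast
    next
      case (Balance t m)
      then show ?thesis using r Inl A[where t = t and m = m]
        by (auto simp: loc_rows_def eq_rows_def)
    next
      case (SocDyn t m)
      then show ?thesis using r Inl A[where t = t and m = m]
        by (auto simp: loc_rows_def eq_rows_def)
    next
      case (ConvSplit t m)
      then show ?thesis using r Inl A[where t = t and m = m]
        by (auto simp: loc_rows_def eq_rows_def)
    next
      case (FlowDef e t m)
      then show ?thesis using r Inl L[where t = t and m = m and e = e]
        by (auto simp: loc_rows_def eq_rows_def)
    qed
  next
    case (Inr q)
    note defs = loc_rows_def in_rows_def inc_lines_def
    show ?thesis
    proof (cases q)
      case (RegB b t m)
      then show ?thesis using r Inr A[where t = t and m = m]
        by (cases b) (auto simp: defs)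
    next
      case (SocB b t m)
      then show ?thesis using r Inr A[where t = t and m = m]
        by (cases b) (auto simp: defs)
    next
      case (ChB b t m)
      then show ?thesis using r Inr A[where t = t and m = m]
        by (cases b) (auto simp: defs)
    next
      case (DisB b t m)
      then show ?thesis using r Inr A[where t = t and m = m]
        by (cases b) (auto simp: defs)
    next
      case (ConvB b t m)
      then show ?thesis using r Inr A[where t = t and m = m]
        by (cases b) (auto simp: defs)
    next
      case (RampB b t m)
      then show ?thesis using r Inr A[where t = t and m = m]
        by (cases b) (auto simp: defs)
    next
      case (ResB b t m)
      then show ?thesis using r Inr A[where t = t and m = m]
        by (cases b) (auto simp: defs)
    next
      case (GenB b g t m)
      then show ?thesis using r Inr U[where t = t and m = m and g = g]
        by (cases b) (auto simp: defs)
    next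
      case (PumpB b g t m)
      then show ?thesis using r Inr U[where t = t and m = m and g = g]
        by (cases b) (auto simp: defs)
    next
      case (SocTerm m) then show ?thesis using r Inr A[where t = 0 and m = m] by (auto simp: defs)
    next
      case (PeakNN m) then show ?thesis using r Inr A[where t = 0 and m = m] by (auto simp: defs)
    next
      case (FlowB b e t m) then show ?thesis using r Inr L[where t = t and m = m and e = e]
        by (intro exI[of _ "Flow e t m"]) (auto simp: defs)
    next
      case (LossCut e k t m) then show ?thesis using r Inr L[where t = t and m = m and e = e]
        by (intro exI[of _ "Flow e t m"]) (auto simp: defs)
    next
      case (QposNN t m) then show ?thesis using r Inr A[where t = t and m = m] by (auto simp: defs)
    next
      case (QnegNN t m) then show ?thesis using r Inr A[where t = t and m = m] by (auto simp: defs)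
    next
      case (PeakCut t m) then show ?thesis using r Inr A[where t = t and m = m] by (auto simp: defs)
    qed
  qed
  then show "r \<in> fst ` entries D i" unfolding entries_def by force
qed

lemma finite_loc_rows: "id_instance D \<Longrightarrow> finite (loc_rows D i)"
  using loc_rows_subset_entries finite_entries by (meson finite_imageI finite_subset)

lemma card_loc_rows_le:
  assumes D: "id_instance D"
  shows "card (loc_rows D i) \<le> (92 + 4 * num_cuts D) * local_size D i"
  using surj_card_le[OF finite_entries[OF D] loc_rows_subset_entries] card_entries_le[OF D] by (rule le_trans)

lemma A_loc_nonzero_entries:
  "r \<in> loc_rows D i \<Longrightarrow> A_loc D i r v \<noteq> 0 \<Longrightarrow> (r, v) \<in> entries D i"
  by (simp add: entries_def A_loc_nonzero_covered)

lemma nnz_A_loc_le: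
  assumes D: "id_instance D"
  shows "nnz (loc_rows D i) (xvars D i) (A_loc D i) \<le> (92 + 4 * num_cuts D) * local_size D i"
proof -
  have "nnz (loc_rows D i) (xvars D i) (A_loc D i) \<le> card (entries D i)"
    unfolding nnz_def using A_loc_nonzero_entries by (intro card_mono finite_entries[OF D]) auto
  then show ?thesis using card_entries_le[OF D] by (rule le_trans)
qed

lemma nnz_Q_loc_le:
  assumes D: "id_instance D"
  shows "nnz (xvars D i) (xvars D i) (Q_loc D i x) \<le> 40 * local_size D i"
proof -
  have "nnz (xvars D i) (xvars D i) (Q_loc D i x) \<le> 2 * card (xvars D i)"
    by (rule nnz_two_per_row[OF finite_xvars[OF D] Q_loc_nonzero])
  then show ?thesis using card_xvars_le[OF D, of i] by linarith
qed

lemma card_times_stage_scen: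
  "finite I \<Longrightarrow> card (I \<times> stages D \<times> scens D) = card I * (horizon D * num_scen D)"
  by (simp add: card_cartesian_product)

text \<open>
  The balance rows exist in every area, whatever its assets; the same holds for the variables
  \<open>Preg\<close> in the next lemma.
\<close>

lemma card_loc_rows_ge:
  assumes D: "id_instance D"
  shows "horizon D * num_scen D \<le> card (loc_rows D i)"
proof -
  have "card (stages D \<times> scens D) \<le> card (loc_rows D i)"
    by (rule card_inj_on_le[where f = "\<lambda>(t, m). Inl (Balance t m)"])
      (use finite_loc_rows[OF D] in \<open>auto simp: inj_on_def loc_rows_def eq_rows_def\<close>)
  then show ?thesis by (simp add: card_cartesian_product)
qed

lemma card_xvars_ge:
  assumes D: "id_instance D"
  shows "horizon D * num_scen D \<le> card (xvars D i)"
proof -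
  have "card (stages D \<times> scens D) \<le> card (xvars D i)"
    by (rule card_inj_on_le[where f = "\<lambda>(t, m). Preg t m"])
      (use finite_xvars[OF D] in \<open>auto simp: inj_on_def xvars_def\<close>)
  then show ?thesis by (simp add: card_cartesian_product)
qed

section \<open>Stacked matrices\<close>

definition total_size :: "id_data \<Rightarrow> nat" where
  "total_size D = (\<Sum>i\<in>areas D. local_size D i)"

text \<open>
  Every unit is placed at one area, so the \<open>g\<^sub>i\<close> add up to at most the number of units.
\<close>

lemma total_size_le:
  assumes D: "id_instance D"
  shows "total_size D \<le> horizon D * num_scen D
    * (num_areas D + card (lines D) + card (units D) + (\<Sum>i\<in>areas D. card (nbrs D i)))"
proof -
  have "(\<Sum>i\<in>areas D. card (units_at D i)) = card (\<Union>i\<in>areas D. units_at D i)"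
    by (rule card_UN_disjoint[symmetric]) (use finite_units_at[OF D] in \<open>auto simp: units_at_def\<close>)
  also have "\<dots> \<le> card (units D)"
    by (rule card_mono) (auto simp: id_instance_finite(2)[OF D] units_at_def)
  finally have "(\<Sum>i\<in>areas D. card (units_at D i)) \<le> card (units D)" .
  moreover have "(\<Sum>i\<in>areas D. 1 + card (nbrs D i) + card (units_at D i))
      = num_areas D + (\<Sum>i\<in>areas D. card (nbrs D i)) + (\<Sum>i\<in>areas D. card (units_at D i))"
    by (simp only: sum.distrib) simp
  ultimately have "(\<Sum>i\<in>areas D. 1 + card (nbrs D i) + card (units_at D i))
      \<le> num_areas D + card (lines D) + card (units D) + (\<Sum>i\<in>areas D. card (nbrs D i))"
    by linarith
  then show ?thesis
    unfolding total_size_def local_size_def sum_distrib_left[symmetric] by (rule mult_le_mono2)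
qed

lemma areas_nonempty: "id_instance D \<Longrightarrow> 1 \<le> num_areas D"
  using id_instance_network(2)[of D] by (meson atLeastAtMost_iff le_trans)

lemma stage_scen_le_total_size:
  assumes D: "id_instance D"
  shows "num_areas D * (horizon D * num_scen D) \<le> total_size D"
proof -
  have "(\<Sum>i\<in>areas D. horizon D * num_scen D) \<le> total_size D"
    unfolding total_size_def local_size_def by (intro sum_mono) simp
  then show ?thesis by simp
qed

text \<open>
  The consistency rows, which are \<open>1 + K\<^sub>i\<close> for each area, stage and scenario.
\<close>

abbreviation consistency_index :: "id_data \<Rightarrow> (nat \<times> nat \<times> nat \<times> nat) set" where
  "consistency_index D \<equiv> (SIGMA i:areas D. insert i (nbrs D i) \<times> stages D \<times> scens D)"

lemma finite_consistency_index: "id_instance D \<Longrightarrow> finite (consistency_index D)"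
  by (simp add: finite_nbrs)

lemma card_consistency_index_le:
  assumes D: "id_instance D"
  shows "card (consistency_index D) \<le> total_size D"
proof -
  have "card (insert i (nbrs D i) \<times> stages D \<times> scens D) \<le> local_size D i" for i
  proof -
    have "card (insert i (nbrs D i)) \<le> 1 + card (nbrs D i) + card (units_at D i)"
      using card_insert_le_m1[of "Suc (card (nbrs D i))" "nbrs D i" i] by simp
    then have "card (insert i (nbrs D i)) * (horizon D * num_scen D)
        \<le> (1 + card (nbrs D i) + card (units_at D i)) * (horizon D * num_scen D)"
      by (rule mult_le_mono1)
    then show ?thesis
      by (simp only: card_times_stage_scen finite_insert finite_nbrs[OF D] local_size_def mult.commute)
  qed
  then have "(\<Sum>i\<in>areas D. card (insert i (nbrs D i) \<times> stages D \<times> scens D)) \<le> total_size D"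
    unfolding total_size_def by (rule sum_mono)
  then show ?thesis by (subst card_SigmaI) (simp_all add: finite_nbrs[OF D])
qed

lemma card_stages_scens_le:
  assumes D: "id_instance D"
  shows "card (stages D \<times> scens D) \<le> total_size D"
proof -
  have "card (stages D \<times> scens D) = 1 * (horizon D * num_scen D)"
    by (simp add: card_cartesian_product)
  also have "\<dots> \<le> num_areas D * (horizon D * num_scen D)"
    by (rule mult_le_mono1[OF areas_nonempty[OF D]])
  also have "\<dots> \<le> total_size D"
    by (rule stage_scen_le_total_size[OF D])
  finally show ?thesis .
qed

lemma card_Sigma_areas_le:
  assumes "\<And>i. finite (X i)" "\<And>i. card (X i) \<le> k * local_size D i"
  shows "card (Sigma (areas D) X) \<le> k * total_size D"
  using assms by (simp add: card_SigmaI total_size_def sum_distrib_left sum_mono)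

fun stack_row :: "nat \<Rightarrow> eq_row + in_row \<Rightarrow> srow" where
  "stack_row i (Inl r) = LocEq i r"
| "stack_row i (Inr r) = LocIn i r"

lemma card_Un3_image_le:
  assumes "finite A" "finite B" "finite C" and "S \<subseteq> f ` A \<union> g ` B \<union> h ` C"
  shows "finite S" "card S \<le> card A + card B + card C"
proof -
  show "finite S" using assms by (meson finite_UnI finite_imageI finite_subset)
  have "card S \<le> card (f ` A \<union> g ` B \<union> h ` C)"
    using assms by (intro card_mono) simp_all
  also have "\<dots> \<le> card (f ` A) + card (g ` B) + card (h ` C)"
    by (meson add_le_mono1 card_Un_le le_trans)
  finally show "card S \<le> card A + card B + card C"
    using card_image_le[OF assms(1), of f] card_image_le[OF assms(2), of g]
      card_image_le[OF assms(3), of h] by linarith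
qed

lemma stack_rows_cases [consumes 1, case_names Local Consistency Reference]:
  assumes "r \<in> stack_rows D"
  obtains (Local) i q where "r = stack_row i q" "i \<in> areas D" "q \<in> loc_rows D i"
    | (Consistency) i a t m where "r = Cons i a t m" "(i, a, t, m) \<in> consistency_index D"
    | (Reference) t m where "r = Ref t m" "(t, m) \<in> stages D \<times> scens D"
proof -
  from assms consider i q where "r = stack_row i (Inl q)" "i \<in> areas D" "q \<in> eq_rows D i"
    | i q where "r = stack_row i (Inr q)" "i \<in> areas D" "q \<in> in_rows D i"
    | i a t m where "r = Cons i a t m" "(i, a, t, m) \<in> consistency_index D"
    | t m where "r = Ref t m" "(t, m) \<in> stages D \<times> scens D"
    unfolding stack_rows_def by auto
  then show thesis
    by cases (use that in \<open>force simp: loc_rows_def\<close>)+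
qed

lemma stack_rows_cover:
  "stack_rows D \<subseteq> (\<lambda>(i, r). stack_row i r) ` Sigma (areas D) (loc_rows D)
     \<union> (\<lambda>(i, a, t, m). Cons i a t m) ` consistency_index D
     \<union> (\<lambda>(t, m). Ref t m) ` (stages D \<times> scens D)"
proof
  fix r assume "r \<in> stack_rows D"
  then show "r \<in> (\<lambda>(i, r). stack_row i r) ` Sigma (areas D) (loc_rows D)
     \<union> (\<lambda>(i, a, t, m). Cons i a t m) ` consistency_index D
     \<union> (\<lambda>(t, m). Ref t m) ` (stages D \<times> scens D)"
    by (cases rule: stack_rows_cases) force+
qed

lemma finite_stack_rows:
  assumes D: "id_instance D"
  shows "finite (stack_rows D)"
  by (rule card_Un3_image_le(1)[OF _ _ _ stack_rows_cover])
    (simp_all add: finite_loc_rows[OF D] finite_nbrs[OF D])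

lemma card_stack_rows_le:
  assumes D: "id_instance D"
  shows "card (stack_rows D) \<le> (94 + 4 * num_cuts D) * total_size D"
proof -
  have "card (stack_rows D) \<le> card (Sigma (areas D) (loc_rows D)) + card (consistency_index D)
      + card (stages D \<times> scens D)"
    by (rule card_Un3_image_le(2)[OF _ _ _ stack_rows_cover])
      (simp_all add: finite_loc_rows[OF D] finite_nbrs[OF D])
  also have "\<dots> \<le> (92 + 4 * num_cuts D) * total_size D + total_size D + total_size D"
    by (intro add_mono card_Sigma_areas_le finite_loc_rows card_loc_rows_le
        card_consistency_index_le card_stages_scens_le D)
  finally show ?thesis by (simp add: algebra_simps)
qed

lemma stack_cols_eq:
  "stack_cols D = (\<lambda>(i, v). XCol i v) ` Sigma (areas D) (xvars D)
     \<union> (\<lambda>(a, t, m). ZCol a t m) ` (areas D \<times> stages D \<times> scens D)"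
proof (rule set_eqI)
  fix c show "c \<in> stack_cols D \<longleftrightarrow> c \<in> (\<lambda>(i, v). XCol i v) ` Sigma (areas D) (xvars D)
     \<union> (\<lambda>(a, t, m). ZCol a t m) ` (areas D \<times> stages D \<times> scens D)"
    by (cases c) (simp_all add: stack_cols_def image_iff del: atLeastAtMost_iff lessThan_iff)
qed

lemma finite_stack_cols: "id_instance D \<Longrightarrow> finite (stack_cols D)"
  unfolding stack_cols_eq by (simp add: finite_xvars)

lemma card_stack_cols_le:
  assumes D: "id_instance D"
  shows "card (stack_cols D) \<le> 21 * total_size D"
proof -
  let ?X = "Sigma (areas D) (xvars D)" and ?Z = "areas D \<times> stages D \<times> scens D"
  have "card (stack_cols D) \<le> card ((\<lambda>(i, v). XCol i v) ` ?X) + card ((\<lambda>(a, t, m). ZCol a t m) ` ?Z)"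
    unfolding stack_cols_eq by (rule card_Un_le)
  also have "\<dots> \<le> card ?X + card ?Z"
    by (intro add_mono card_image_le) (simp_all add: finite_xvars[OF D])
  also have "card ?X \<le> 20 * total_size D"
    by (intro card_Sigma_areas_le finite_xvars card_xvars_le D)
  also have "card ?Z \<le> total_size D"
    using stage_scen_le_total_size[OF D] by (simp add: card_cartesian_product)
  finally show ?thesis by simp
qed

text \<open>
  Besides the local entries there are two for each consistency row (the copy and \<open>z\<close>) and one for
  each reference row. These contribute \<open>3\<close> to the constant.
\<close>

lemma nnz_A_stack_le:
  assumes D: "id_instance D"
  shows "nnz (stack_rows D) (stack_cols D) (A_stack D) \<le> (95 + 4 * num_cuts D) * total_size D"
proof -
  let ?S = "{(r, c). r \<in> stack_rows D \<and> c \<in> stack_cols D \<and> A_stack D r c \<noteq> 0}"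
  let ?loc = "(\<lambda>(i, r, v). (stack_row i r, XCol i v)) ` Sigma (areas D) (entries D)"
  let ?consX = "(\<lambda>(i, a, t, m). (Cons i a t m, XCol i (Theta a t m))) ` consistency_index D"
  let ?consZ = "(\<lambda>(i, a, t, m). (Cons i a t m, ZCol a t m)) ` consistency_index D"
  let ?ref = "(\<lambda>(t, m). (Ref t m, ZCol (ref_area D) t m)) ` (stages D \<times> scens D)"
  have sub: "?S \<subseteq> (?loc \<union> ?consX \<union> ?ref) \<union> ?consZ"
  proof
    fix p assume "p \<in> ?S"
    then obtain r c where p: "p = (r, c)" "r \<in> stack_rows D" "A_stack D r c \<noteq> 0" by blast
    from p(2) show "p \<in> (?loc \<union> ?consX \<union> ?ref) \<union> ?consZ"
    proof (cases rule: stack_rows_cases)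
      case (Local i q)
      with p(3) obtain v where c: "c = XCol i v" "A_loc D i q v \<noteq> 0"
        by (cases q; cases c) (auto simp: A_loc_def split: if_splits)
      then have "(i, q, v) \<in> Sigma (areas D) (entries D)"
        using A_loc_nonzero_entries Local by blast
      then have "p \<in> ?loc"
        by (rule rev_image_eqI) (simp add: p(1) Local(1) c(1))
      then show ?thesis by blast
    next
      case (Consistency i a t m)
      then have "c = XCol i (Theta a t m) \<or> c = ZCol a t m"
        using p(3) by (cases c) (auto split: if_splits)
      then have "p = (Cons i a t m, XCol i (Theta a t m)) \<or> p = (Cons i a t m, ZCol a t m)"
        by (simp add: p(1) Consistency(1))
      then have "p \<in> ?consX \<or> p \<in> ?consZ"
        by (elim disj_forward) (rule rev_image_eqI[OF Consistency(2)], simp)+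
      then show ?thesis by blast
    next
      case (Reference t m)
      then have "c = ZCol (ref_area D) t m"
        using p(3) by (cases c) (auto split: if_splits)
      then have "p \<in> ?ref"
        by (intro rev_image_eqI[OF Reference(2)]) (simp add: p(1) Reference(1))
      then show ?thesis by blast
    qed
  qed
  have "card ?S \<le> card ((?loc \<union> ?consX \<union> ?ref) \<union> ?consZ)"
    by (rule card_mono[OF _ sub]) (simp add: finite_entries[OF D] finite_nbrs[OF D])
  also have "\<dots> \<le> card (?loc \<union> ?consX \<union> ?ref) + card ?consZ"
    by (rule card_Un_le)
  also have "card (?loc \<union> ?consX \<union> ?ref)
      \<le> card (Sigma (areas D) (entries D)) + card (consistency_index D) + card (stages D \<times> scens D)"
    by (rule card_Un3_image_le(2)[OF _ _ _ subset_refl])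
      (simp_all add: finite_entries[OF D] finite_nbrs[OF D])
  also have "\<dots> \<le> (92 + 4 * num_cuts D) * total_size D + total_size D + total_size D"
    by (intro add_mono card_Sigma_areas_le finite_entries card_entries_le
        card_consistency_index_le card_stages_scens_le D)
  also have "card ?consZ \<le> card (consistency_index D)"
    by (rule card_image_le[OF finite_consistency_index[OF D]])
  also have "\<dots> \<le> total_size D"
    by (rule card_consistency_index_le[OF D])
  finally show ?thesis by (simp add: nnz_def algebra_simps)
qed

fun stack_partner :: "scol \<Rightarrow> scol" where
  "stack_partner (XCol i v) = XCol i (partner v)"
| "stack_partner c = c"

lemma Q_stack_nonzero: "Q_stack D x c d \<noteq> 0 \<Longrightarrow> c = d \<or> d = stack_partner c"
  using Q_loc_nonzero by (cases c; cases d) (auto split: if_splits)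

lemma nnz_Q_stack_le:
  assumes D: "id_instance D"
  shows "nnz (stack_cols D) (stack_cols D) (Q_stack D x) \<le> 42 * total_size D"
proof -
  have "nnz (stack_cols D) (stack_cols D) (Q_stack D x) \<le> 2 * card (stack_cols D)"
    by (rule nnz_two_per_row[OF finite_stack_cols[OF D] Q_stack_nonzero])
  then show ?thesis using card_stack_cols_le[OF D] by linarith
qed

lemma card_stack_rows_ge:
  assumes D: "id_instance D"
  shows "num_areas D * horizon D * num_scen D \<le> card (stack_rows D)"
proof -
  have "card (areas D \<times> stages D \<times> scens D) \<le> card (stack_rows D)"
    by (rule card_inj_on_le[OF _ _ finite_stack_rows[OF D], where f = "\<lambda>(i, t, m). LocEq i (Balance t m)"])
      (auto simp: inj_on_def stack_rows_def eq_rows_def)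
  then show ?thesis by (simp add: card_cartesian_product mult.assoc)
qed

lemma card_stack_cols_ge:
  assumes D: "id_instance D"
  shows "num_areas D * horizon D * num_scen D \<le> card (stack_cols D)"
proof -
  have "card (areas D \<times> stages D \<times> scens D) \<le> card (stack_cols D)"
    by (rule card_inj_on_le[OF _ _ finite_stack_cols[OF D], where f = "\<lambda>(a, t, m). ZCol a t m"])
      (auto simp: inj_on_def stack_cols_def)
  then show ?thesis by (simp add: card_cartesian_product mult.assoc)
qed

section \<open>Centralized formulation\<close>

text \<open>
  A nonzero sum has a nonzero summand, so each nonzero of the substituted matrix lies under a
  nonzero of the stacked one. Deleting redundant rows can only help.
\<close>

lemma nnz_A_central_le:
  assumes D: "id_instance D"
  shows "nnz (central_rows D) (central_cols D) (A_central D) \<le> nnz (stack_rows D) (stack_cols D) (A_stack D)"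
proof -
  let ?S = "{(r, c). r \<in> stack_rows D \<and> c \<in> stack_cols D \<and> A_stack D r c \<noteq> 0}"
  have "{(r, c). r \<in> central_rows D \<and> c \<in> central_cols D \<and> A_central D r c \<noteq> 0}
      \<subseteq> (\<lambda>(r, w). (r, physical w)) ` ?S"
  proof clarify
    fix r c assume "r \<in> central_rows D" "A_central D r c \<noteq> 0"
    then obtain w where "w \<in> stack_cols D" "physical w = c" "A_stack D r w \<noteq> 0"
      unfolding A_central_def by (auto elim: sum.not_neutral_contains_not_neutral)
    then show "(r, c) \<in> (\<lambda>(r, w). (r, physical w)) ` ?S"
      using \<open>r \<in> central_rows D\<close> by (force simp: central_rows_def)
  qed
  then show ?thesis
    unfolding nnz_def
    by (rule surj_card_le[OF finite_nonzeros[OF finite_stack_rows[OF D] finite_stack_cols[OF D]]])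
qed

lemma nnz_Q_central_le:
  assumes D: "id_instance D"
  shows "nnz (central_cols D) (central_cols D) (Q_central D y) \<le> 42 * total_size D"
proof -
  have fin: "finite (central_cols D)"
    unfolding central_cols_def using finite_stack_cols[OF D] by (rule finite_imageI)
  have "nnz (central_cols D) (central_cols D) (Q_central D y) \<le> 2 * card (central_cols D)"
    by (rule nnz_two_per_row[OF fin Q_central_nonzero])
  also have "card (central_cols D) \<le> card (stack_cols D)"
    unfolding central_cols_def using finite_stack_cols[OF D] by (rule card_image_le)
  finally show ?thesis using card_stack_cols_le[OF D] by linarith
qed

section \<open>Complexity estimates\<close>

lemma mat_density_le:
  assumes "real (nnz R C A) \<le> c * s" "s > 0" "c \<ge> 0" "s \<le> real (card R)" "s \<le> real (card C)"
  shows "mat_density R C A \<le> c * inverse s"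
proof -
  have "mat_density R C A \<le> (c * s) / (s * s)"
    unfolding mat_density_def using assms by (intro frac_le mult_mono) simp_all
  then show ?thesis using assms(2) by (simp add: field_simps)
qed

lemma mat_density_nonneg: "0 \<le> mat_density R C A"
  by (simp add: mat_density_def)

lemma local_complexity_le:
  assumes D: "id_instance D"
  shows "card (loc_rows D i) + nnz (loc_rows D i) (xvars D i) (A_loc D i)
      + nnz (xvars D i) (xvars D i) (Q_loc D i x) \<le> (224 + 8 * num_cuts D) * local_size D i"
  using add_mono[OF add_mono[OF card_loc_rows_le nnz_A_loc_le] nnz_Q_loc_le, OF D D D, of i i i x]
  by (simp add: algebra_simps)

lemma stack_complexity_le:
  assumes D: "id_instance D"
  shows "nnz (stack_rows D) (stack_cols D) (A_stack D)
      + nnz (stack_cols D) (stack_cols D) (Q_stack D x) \<le> (137 + 4 * num_cuts D) * total_size D"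
  using add_mono[OF nnz_A_stack_le nnz_Q_stack_le, OF D D, of x] by (simp add: algebra_simps)

lemma central_complexity_le:
  assumes D: "id_instance D"
  shows "nnz (central_rows D) (central_cols D) (A_central D)
      + nnz (central_cols D) (central_cols D) (Q_central D y) \<le> (137 + 4 * num_cuts D) * total_size D"
  using add_mono[OF le_trans[OF nnz_A_central_le nnz_A_stack_le] nnz_Q_central_le, OF D D D, of y]
  by (simp add: algebra_simps)

lemma bounded_local_size_le:
  assumes "D \<in> bounded_instances K\<^sub>l K\<^sub>b g\<^sub>b" and "i \<in> areas D"
  shows "local_size D i \<le> (1 + K\<^sub>b + g\<^sub>b) * (horizon D * num_scen D)"
proof -
  have "1 + card (nbrs D i) + card (units_at D i) \<le> 1 + K\<^sub>b + g\<^sub>b"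
    using assms by (auto simp: bounded_instances_def intro: add_mono)
  then show ?thesis unfolding local_size_def by (subst mult.commute) (rule mult_le_mono1)
qed

lemma bounded_total_size_le:
  assumes "D \<in> bounded_instances K\<^sub>l K\<^sub>b g\<^sub>b"
  shows "total_size D \<le> (1 + K\<^sub>b + g\<^sub>b) * (num_areas D * horizon D * num_scen D)"
proof -
  have "total_size D \<le> (\<Sum>i\<in>areas D. (1 + K\<^sub>b + g\<^sub>b) * (horizon D * num_scen D))"
    unfolding total_size_def by (rule sum_mono) (rule bounded_local_size_le[OF assms])
  then show ?thesis by (simp add: mult_ac)
qed

lemma bounded_le:
  fixes x :: nat
  assumes "x \<le> k * s" "s \<le> b * n"
  shows "real x \<le> real (k * b) * real n"
proof -
  have "x \<le> k * (b * n)" using assms mult_le_mono2 le_trans by blast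
  then have "real x \<le> real (k * (b * n))" by (rule of_nat_mono)
  then show ?thesis by (simp add: mult_ac)
qed

theorem proposition15:
  fixes K\<^sub>l :: nat
  shows
    "(\<exists>C>0. \<forall>D\<in>instances K\<^sub>l. \<forall>i\<in>areas D. \<forall>x.
        real (card (loc_rows D i)) + real (nnz (loc_rows D i) (xvars D i) (A_loc D i))
          + real (nnz (xvars D i) (xvars D i) (Q_loc D i x))
        \<le> C * real (horizon D * num_scen D) * (1 + real (card (nbrs D i)) + real (card (units_at D i))))
     \<and> (\<lambda>(D, x). real (nnz (stack_rows D) (stack_cols D) (A_stack D))
                  + real (nnz (stack_cols D) (stack_cols D) (Q_stack D x)))
        \<in> O[principal (instances K\<^sub>l \<times> UNIV)](\<lambda>(D, x). real (horizon D * num_scen D)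
             * real (num_areas D + card (lines D) + card (units D) + (\<Sum>i\<in>areas D. card (nbrs D i))))
     \<and> (\<lambda>(D, y). real (nnz (central_rows D) (central_cols D) (A_central D))
                  + real (nnz (central_cols D) (central_cols D) (Q_central D y)))
        \<in> O[principal (instances K\<^sub>l \<times> UNIV)](\<lambda>(D, y). real (horizon D * num_scen D)
             * real (num_areas D + card (lines D) + card (units D) + (\<Sum>i\<in>areas D. card (nbrs D i))))
     \<and> (\<forall>K\<^sub>b g\<^sub>b.
         (let S = bounded_instances K\<^sub>l K\<^sub>b g\<^sub>b;
              F = principal (Sigma S areas);
              HM = (\<lambda>D. real (horizon D * num_scen D));
              NHM = (\<lambda>D. real (num_areas D * horizon D * num_scen D))
          in (\<lambda>(D, i). real (card (loc_rows D i))) \<in> \<Theta>[F](\<lambda>(D, i). HM D)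
           \<and> (\<lambda>(D, i). real (card (xvars D i))) \<in> \<Theta>[F](\<lambda>(D, i). HM D)
           \<and> (\<lambda>(D, i). mat_density (loc_rows D i) (xvars D i) (A_loc D i)) \<in> O[F](\<lambda>(D, i). inverse (HM D))
           \<and> (\<lambda>((D, i), x). mat_density (xvars D i) (xvars D i) (Q_loc D i x))
               \<in> O[principal (Sigma S areas \<times> UNIV)](\<lambda>((D, i), x). inverse (HM D))
           \<and> (\<lambda>D. real (card (stack_rows D))) \<in> \<Theta>[principal S](NHM)
           \<and> (\<lambda>D. real (card (stack_cols D))) \<in> \<Theta>[principal S](NHM)
           \<and> (\<lambda>D. mat_density (stack_rows D) (stack_cols D) (A_stack D)) \<in> O[principal S](\<lambda>D. inverse (NHM D))
           \<and> (\<lambda>(D, x). mat_density (stack_cols D) (stack_cols D) (Q_stack D x))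
               \<in> O[principal (S \<times> UNIV)](\<lambda>(D, x). inverse (NHM D))))"
  proof (intro conjI allI)
  show "\<exists>C>0. \<forall>D\<in>instances K\<^sub>l. \<forall>i\<in>areas D. \<forall>x.
        real (card (loc_rows D i)) + real (nnz (loc_rows D i) (xvars D i) (A_loc D i))
          + real (nnz (xvars D i) (xvars D i) (Q_loc D i x))
        \<le> C * real (horizon D * num_scen D) * (1 + real (card (nbrs D i)) + real (card (units_at D i)))"
  proof (intro exI[of _ "real (224 + 8 * K\<^sub>l)"] conjI ballI allI)
    fix D i x assume "D \<in> instances K\<^sub>l"
    then have D: "id_instance D" "num_cuts D = K\<^sub>l" by (simp_all add: instances_def)
    have "card (loc_rows D i) + nnz (loc_rows D i) (xvars D i) (A_loc D i)
        + nnz (xvars D i) (xvars D i) (Q_loc D i x)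
      \<le> (224 + 8 * K\<^sub>l) * (horizon D * num_scen D) * (1 + card (nbrs D i) + card (units_at D i))"
      using local_complexity_le[OF D(1), of i x] unfolding D(2) local_size_def by (simp only: mult.assoc)
    from of_nat_mono[OF this, where 'a = real]
    show "real (card (loc_rows D i)) + real (nnz (loc_rows D i) (xvars D i) (A_loc D i))
          + real (nnz (xvars D i) (xvars D i) (Q_loc D i x))
        \<le> real (224 + 8 * K\<^sub>l) * real (horizon D * num_scen D)
          * (1 + real (card (nbrs D i)) + real (card (units_at D i)))"
      by (simp only: of_nat_add of_nat_mult of_nat_1)
  qed simp
next
  let ?size = "\<lambda>D. horizon D * num_scen D
     * (num_areas D + card (lines D) + card (units D) + (\<Sum>i\<in>areas D. card (nbrs D i)))"
  have size: "real a + real b \<le> real (137 + 4 * K\<^sub>l) * (real (horizon D * num_scen D)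
       * real (num_areas D + card (lines D) + card (units D) + (\<Sum>i\<in>areas D. card (nbrs D i))))"
    if "D \<in> instances K\<^sub>l" "a + b \<le> (137 + 4 * num_cuts D) * total_size D" for D a b
  proof -
    have D: "id_instance D" "num_cuts D = K\<^sub>l" using that(1) by (simp_all add: instances_def)
    have "a + b \<le> (137 + 4 * K\<^sub>l) * ?size D"
      using that(2) mult_le_mono2[OF total_size_le[OF D(1)]] unfolding D(2) by (rule le_trans)
    from of_nat_mono[OF this, where 'a = real] show ?thesis by (simp only: of_nat_add of_nat_mult)
  qed
  have pos: "0 < real (137 + 4 * K\<^sub>l)" by simp
  show "(\<lambda>(D, x). real (nnz (stack_rows D) (stack_cols D) (A_stack D))
                  + real (nnz (stack_cols D) (stack_cols D) (Q_stack D x)))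
        \<in> O[principal (instances K\<^sub>l \<times> UNIV)](\<lambda>(D, x). real (horizon D * num_scen D)
             * real (num_areas D + card (lines D) + card (units D) + (\<Sum>i\<in>areas D. card (nbrs D i))))"
    by (rule bigo_principal_SigmaI, rule pos, simp)
      (rule size, assumption, rule stack_complexity_le, simp add: instances_def)
  show "(\<lambda>(D, y). real (nnz (central_rows D) (central_cols D) (A_central D))
                  + real (nnz (central_cols D) (central_cols D) (Q_central D y)))
        \<in> O[principal (instances K\<^sub>l \<times> UNIV)](\<lambda>(D, y). real (horizon D * num_scen D)
             * real (num_areas D + card (lines D) + card (units D) + (\<Sum>i\<in>areas D. card (nbrs D i))))"
    by (rule bigo_principal_SigmaI, rule pos, simp)
      (rule size, assumption, rule central_complexity_le, simp add: instances_def)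
next
  fix K\<^sub>b g\<^sub>b :: nat
  show "let S = bounded_instances K\<^sub>l K\<^sub>b g\<^sub>b;
              F = principal (Sigma S areas);
              HM = (\<lambda>D. real (horizon D * num_scen D));
              NHM = (\<lambda>D. real (num_areas D * horizon D * num_scen D))
          in (\<lambda>(D, i). real (card (loc_rows D i))) \<in> \<Theta>[F](\<lambda>(D, i). HM D)
           \<and> (\<lambda>(D, i). real (card (xvars D i))) \<in> \<Theta>[F](\<lambda>(D, i). HM D)
           \<and> (\<lambda>(D, i). mat_density (loc_rows D i) (xvars D i) (A_loc D i)) \<in> O[F](\<lambda>(D, i). inverse (HM D))
           \<and> (\<lambda>((D, i), x). mat_density (xvars D i) (xvars D i) (Q_loc D i x))
               \<in> O[principal (Sigma S areas \<times> UNIV)](\<lambda>((D, i), x). inverse (HM D))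
           \<and> (\<lambda>D. real (card (stack_rows D))) \<in> \<Theta>[principal S](NHM)
           \<and> (\<lambda>D. real (card (stack_cols D))) \<in> \<Theta>[principal S](NHM)
           \<and> (\<lambda>D. mat_density (stack_rows D) (stack_cols D) (A_stack D)) \<in> O[principal S](\<lambda>D. inverse (NHM D))
           \<and> (\<lambda>(D, x). mat_density (stack_cols D) (stack_cols D) (Q_stack D x))
               \<in> O[principal (S \<times> UNIV)](\<lambda>(D, x). inverse (NHM D))"
    unfolding Let_def
  proof (intro conjI)
    let ?S = "bounded_instances K\<^sub>l K\<^sub>b g\<^sub>b" and ?b = "1 + K\<^sub>b + g\<^sub>b"
    let ?HM = "\<lambda>D. horizon D * num_scen D" and ?NHM = "\<lambda>D. num_areas D * horizon D * num_scen D"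
    \<comment> \<open>\<open>95 + 4 * K\<^sub>l\<close>, from \<open>nnz_A_stack_le\<close>, is the largest factor in the counts to be combined.\<close>
    let ?c = "real ((95 + 4 * K\<^sub>l) * ?b)"
    have S: "id_instance D" "num_cuts D = K\<^sub>l" if "D \<in> ?S" for D
      using that by (simp_all add: bounded_instances_def instances_def)
    have c: "0 < ?c" by (simp only: of_nat_0_less_iff) simp
    have HM: "0 < real (?HM D)" if "D \<in> ?S" for D
      using id_instance_finite(3,4)[OF S(1)[OF that]] by simp
    have NHM: "0 < real (?NHM D)" if "D \<in> ?S" for D
      using id_instance_finite(3,4)[OF S(1)[OF that]] areas_nonempty[OF S(1)[OF that]] by simp
    have loc: "real a \<le> ?c * real (?HM D)"
      if "D \<in> ?S" "i \<in> areas D" "a \<le> k * local_size D i" "k \<le> 95 + 4 * K\<^sub>l" for D i a k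
      using that(3) mult_le_mono1[OF that(4)] bounded_local_size_le[OF that(1,2)]
      by (intro bounded_le[of _ _ "local_size D i"]) (rule le_trans)
    have tot: "real a \<le> ?c * real (?NHM D)"
      if "D \<in> ?S" "a \<le> k * total_size D" "k \<le> 95 + 4 * K\<^sub>l" for D a k
      using that(2) mult_le_mono1[OF that(3)] bounded_total_size_le[OF that(1)]
      by (intro bounded_le[of _ _ "total_size D"]) (rule le_trans)
    show "(\<lambda>(D, i). real (card (loc_rows D i))) \<in> \<Theta>[principal (Sigma ?S areas)](\<lambda>(D, i). real (?HM D))"
      by (rule bigtheta_principal_SigmaI[OF _ _ _ c])
        (simp, simp only: of_nat_le_iff card_loc_rows_ge S, rule loc, assumption, assumption,
         rule card_loc_rows_le, simp_all add: S)
    show "(\<lambda>(D, i). real (card (xvars D i))) \<in> \<Theta>[principal (Sigma ?S areas)](\<lambda>(D, i). real (?HM D))"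
      by (rule bigtheta_principal_SigmaI[OF _ _ _ c])
        (simp, simp only: of_nat_le_iff card_xvars_ge S, rule loc, assumption, assumption,
         rule card_xvars_le, simp_all add: S)
    show "(\<lambda>(D, i). mat_density (loc_rows D i) (xvars D i) (A_loc D i))
        \<in> O[principal (Sigma ?S areas)](\<lambda>(D, i). inverse (real (?HM D)))"
    proof (rule bigo_principal_SigmaI[OF c mat_density_nonneg])
      fix D i assume "D \<in> ?S" "i \<in> areas D"
      then show "mat_density (loc_rows D i) (xvars D i) (A_loc D i) \<le> ?c * inverse (real (?HM D))"
        using S[of D] by (intro mat_density_le less_imp_le[OF c] loc[OF _ _ nnz_A_loc_le] HM of_nat_mono
            card_loc_rows_ge card_xvars_ge) simp_all
    qed
    show "(\<lambda>((D, i), x). mat_density (xvars D i) (xvars D i) (Q_loc D i x))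
        \<in> O[principal (Sigma ?S areas \<times> UNIV)](\<lambda>((D, i), x). inverse (real (?HM D)))"
    proof (rule bigo_principal_SigmaI[OF c])
      fix p x assume "p \<in> Sigma ?S areas"
      then obtain D i where p: "p = (D, i)" and "D \<in> ?S" "i \<in> areas D" by blast
      then have "mat_density (xvars D i) (xvars D i) (Q_loc D i x) \<le> ?c * inverse (real (?HM D))"
        using S[of D] by (intro mat_density_le less_imp_le[OF c] loc[OF _ _ nnz_Q_loc_le] HM of_nat_mono card_xvars_ge)
          simp_all
      then show "(case p of (D, i) \<Rightarrow> \<lambda>x. mat_density (xvars D i) (xvars D i) (Q_loc D i x)) x
          \<le> ?c * (case p of (D, i) \<Rightarrow> \<lambda>x. inverse (real (?HM D))) x"
        by (simp only: p prod.case)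
    qed (auto simp: mat_density_nonneg)
    show "(\<lambda>D. real (card (stack_rows D))) \<in> \<Theta>[principal ?S](\<lambda>D. real (?NHM D))"
      by (rule bigtheta_principalI[OF _ _ _ c])
        (simp, simp only: of_nat_le_iff card_stack_rows_ge S, rule tot, assumption,
         rule card_stack_rows_le, simp_all add: S)
    show "(\<lambda>D. real (card (stack_cols D))) \<in> \<Theta>[principal ?S](\<lambda>D. real (?NHM D))"
      by (rule bigtheta_principalI[OF _ _ _ c])
        (simp, simp only: of_nat_le_iff card_stack_cols_ge S, rule tot, assumption,
         rule card_stack_cols_le, simp_all add: S)
    show "(\<lambda>D. mat_density (stack_rows D) (stack_cols D) (A_stack D))
        \<in> O[principal ?S](\<lambda>D. inverse (real (?NHM D)))"
    proof (rule bigo_principalI[OF c mat_density_nonneg])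
      fix D assume "D \<in> ?S"
      then show "mat_density (stack_rows D) (stack_cols D) (A_stack D) \<le> ?c * inverse (real (?NHM D))"
        using S[of D] by (intro mat_density_le less_imp_le[OF c] tot[OF _ nnz_A_stack_le] NHM of_nat_mono
            card_stack_rows_ge card_stack_cols_ge) simp_all
    qed
    show "(\<lambda>(D, x). mat_density (stack_cols D) (stack_cols D) (Q_stack D x))
        \<in> O[principal (?S \<times> UNIV)](\<lambda>(D, x). inverse (real (?NHM D)))"
    proof (rule bigo_principal_SigmaI[OF c mat_density_nonneg])
      fix D x assume "D \<in> ?S"
      then show "mat_density (stack_cols D) (stack_cols D) (Q_stack D x) \<le> ?c * inverse (real (?NHM D))"
        using S[of D] by (intro mat_density_le less_imp_le[OF c] tot[OF _ nnz_Q_stack_le] NHM of_nat_mono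
            card_stack_cols_ge) simp_all
    qed
  qed
qed

end
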